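(* Let $A\in\mathbb{R}^{m\times N}$ and $f\in\mathbb{R}^m$. Assume that the one-at-a-time condition holds and that $A_{\mathcal{E}(t^j)}$ is injective at every iteration $j$ (with $t^j>0$) of the standard homotopy method. Then the outputs (number of steps $K$, parameters $t^0,\dots,t^K$, and solutions $u(t^0),\dots,u(t^K)$) of the standard homotopy method and of the generalized homotopy method, applied to $(A,f)$, coincide.
   Context: Notation. $[N]=\{1,\dots,N\}$; $A_i$ is the $i$-th column of $A$; for $S\subseteq[N]$, $A_S$ is the submatrix of columns indexed by $S$, $A_S^T=(A_S)^T$, and $v_S$ the subvector of $v\in\mathbb{R}^N$ indexed by $S$; $S^C=[N]\setminus S$; $M^\dagger$ is the (Moore–Penrose) pseudoinverse. For $t>0$, $U_t:=\operatorname{argmin}_{u\in\mathbb{R}^N}\frac12\|Au-f\|_2^2+t\|u\|_1$ (the set of minimizers), and $U_0:=\operatorname{argmin}\{\|u\|_1: u\in\mathbb{R}^N,\ A^T(Au-f)=0\}$. Active set: $\mathcal{A}(u)=\{i\in[N]:u_i\ne0\}$. Equicorrelation set: $\mathcal{E}(t,u)=\{i\in[N]:|A_i^T(Au-f)|=t\}$; $\mathcal{E}(t):=\mathcal{E}(t,u(t))$ for $u(t)\in U_t$ (independent of the choice of $u(t)\in U_t$). For $t>0$, $p(t):=\frac1tA^T(f-Au(t))$ for $u(t)\in U_t$ (also independent of the choice). Generalized homotopy method. Initialize $t^0=\|A^Tf\|_\infty$, $u(t^0)=0$. For $j=0,1,2,\dots$: (1) If $t^j=0$, stop and set $K=j$.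 (2) Let $\mathcal{D}$ be the set of minimizers of $\|Ad-\frac1{t^j}(f-Au(t^j))\|_2^2$ over all $d\in\mathbb{R}^N$ with $d_{\mathcal{E}(t^j)^C}=0$ and $d_i\,p(t^j)_i\ge0$ for all $i\in\mathcal{E}(t^j)\setminus\mathcal{A}(u(t^j))$, and let $d^{j+1}$ be the unique element of $\mathcal{D}$ of minimal $\ell_2$-norm. (3) Let $t^{j+1}\ge0$ be the minimal number such that $u(t):=u(t^j)+(t^j-t)d^{j+1}\in U_t$ for all $t\in[t^{j+1},t^j]$; set $u(t^{j+1})=u(t^j)+(t^j-t^{j+1})d^{j+1}$. Standard homotopy method. Initialize $t^0=\|A^Tf\|_\infty$, $u(t^0)=0$. For $j=0,1,2,\dots$: (1) If $t^j=0$, stop and set $K=j$. (2) Set $\mathrm{Leav}^j=\mathcal{A}(u(t^{j-1}))\setminus\mathcal{A}(u(t^j))$ and $S^j=\mathcal{E}(t^j)\setminus\mathrm{Leav}^j$, and define $d^{j+1}$ by $d^{j+1}_{S^j}=(A_{S^j}^TA_{S^j})^\dagger p(t^j)_{S^j}$ and $d^{j+1}_{(S^j)^C}=0$. (3) Let $t^{j+1}\ge0$ be the minimal number such that $u(t):=u(t^j)+(t^j-t)d^{j+1}\in U_t$ for all $t\in[t^{j+1},t^j]$; set $u(t^{j+1})=u(t^j)+(t^j-t^{j+1})d^{j+1}$. If $t^{j+1}=t^j$, report an error (failure to produce a solution path). One-at-a-time condition. For the sequence produced by the standard homotopy method let $\mathrm{Leav}^j=\mathcal{A}(u(t^{j-1}))\setminus\mathcal{A}(u(t^j))$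 (leaving coordinates) and $\mathrm{Hit}^j=\mathcal{E}(t^j)\setminus\mathcal{E}(t^{j-1})$ (hitting coordinates), with the convention $\mathcal{A}(u(t^{-1}))=\mathcal{E}(t^{-1})=\emptyset$ for $j=0$. The condition holds if $|\mathrm{Hit}^j\,\dot\cup\,\mathrm{Leav}^j|\le1$ for every iteration $0\le j\le K$ with $t^j>0$.
   Formalization: Added assumption: either the standard method stops without error (K exists), or whenever a coordinate that left at one iteration is back in the equicorrelation set at the next, no coordinate hits or leaves there. Without it, the standard method can report an error. *)

theory Defs
  imports "HOL-Analysis.Analysis"
begin

section \<open>Column submatrices and the pseudoinverse\<close>

text \<open>
  For an index set S, vectors with index set S are identified with the vectors that vanish
  outside S. Accordingly the submatrix of the columns indexed by S keeps its shape and has zero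
  columns outside S. Products and transposes respect this zero padding, and so does the
  pseudoinverse: it vanishes again outside S \<open>\<times>\<close> S (lemma \<open>pinv_gram_outside\<close>), so
  that all sums in the Penrose equations below run effectively over S only.
\<close>

definition cols :: "real^'n^'m \<Rightarrow> 'n set \<Rightarrow> real^'n^'m" where
  "cols A S = (\<chi> r i. if i \<in> S then A $ r $ i else 0)"

definition subvec :: "real^'n \<Rightarrow> 'n set \<Rightarrow> real^'n" where
  "subvec v S = (\<chi> i. if i \<in> S then v $ i else 0)"

definition supported :: "'n set \<Rightarrow> (real^'n) set" where
  "supported S = {v. \<forall>i. i \<notin> S \<longrightarrow> v $ i = 0}"

definition is_pinv :: "real^'n^'m \<Rightarrow> real^'m^'n \<Rightarrow> bool" where
  "is_pinv M X \<longleftrightarrow>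
     M ** X ** M = M \<and> X ** M ** X = X \<and>
     transpose (M ** X) = M ** X \<and> transpose (X ** M) = X ** M"

definition pinv :: "real^'n^'m \<Rightarrow> real^'m^'n" where
  "pinv M = (THE X. is_pinv M X)"

lemma generalized_inverse_exists:
  fixes M :: "real^'n^'m"
  shows "\<exists>Z::real^'m^'n. M ** Z ** M = M"
proof -
  obtain g :: "real^'m \<Rightarrow> real^'n"
    where "linear g" and g: "\<And>v. M *v g (M *v v) = M *v v"
    using linear_exists_right_inverse_on[of "(*v) M" UNIV] by auto
  have *: "matrix g *v x = g x" for x
    using \<open>linear g\<close> by (simp add: matrix_works)
  have "M ** matrix g ** M = M"
    by (simp add: matrix_eq * g flip: matrix_vector_mul_assoc)
  then show ?thesis ..
qed

lemma matrix_mul_diff_right: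
  fixes A :: "real^'n^'m" and B C :: "real^'k^'n"
  shows "A ** (B - C) = A ** B - A ** C"
  by (simp add: matrix_matrix_mult_def vec_eq_iff sum_subtractf right_diff_distrib)

lemma gram_cancel:
  fixes M :: "real^'n^'m" and W :: "real^'k^'n"
  assumes "transpose M ** M ** W = 0"
  shows "M ** W = 0"
proof -
  have "M *v (W *v x) = 0" for x
  proof -
    have "transpose M *v (M *v (W *v x)) = 0"
      using assms by (simp add: matrix_vector_mul_assoc matrix_mul_assoc)
    then have "(M *v (W *v x)) \<bullet> (M *v (W *v x)) = 0"
      by (metis dot_lmul_matrix inner_zero_right transpose_transpose vector_transpose_matrix)
    then show ?thesis
      by simp
  qed
  then show ?thesis
    by (simp add: matrix_eq matrix_vector_mul_assoc)
qed

lemma least_squares_inverse_exists: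
  fixes M :: "real^'n^'m"
  shows "\<exists>X::real^'m^'n. M ** X ** M = M \<and> transpose (M ** X) = M ** X"
proof -
  obtain Z :: "real^'n^'n"
    where Z: "(transpose M ** M) ** Z ** (transpose M ** M) = transpose M ** M"
    using generalized_inverse_exists by blast
  define X where "X = Z ** transpose M"
  have "transpose M ** M ** (X ** M - mat 1) = 0"
    using Z by (simp add: X_def matrix_mul_diff_right matrix_mul_assoc)
  then have "M ** (X ** M - mat 1) = 0"
    by (rule gram_cancel)
  then have 1: "M ** X ** M = M"
    by (simp add: matrix_mul_diff_right matrix_mul_assoc)
  define P where "P = M ** X"
  have "P ** transpose P = P ** M ** transpose Z ** transpose M"
    by (simp add: P_def X_def matrix_transpose_mul matrix_mul_assoc)
  also have "\<dots> = transpose P"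
    using 1 by (simp add: P_def X_def matrix_transpose_mul matrix_mul_assoc)
  finally have "P ** transpose P = transpose P" .
  then have "transpose P = P"
    by (metis matrix_transpose_mul transpose_transpose)
  with 1 show ?thesis
    by (auto simp: P_def)
qed

lemma is_pinv_exists:
  fixes M :: "real^'n^'m"
  shows "\<exists>X. is_pinv M X"
proof -
  obtain X :: "real^'m^'n" where X: "M ** X ** M = M" "transpose (M ** X) = M ** X"
    using least_squares_inverse_exists by blast
  obtain W :: "real^'n^'m" where W:
    "transpose M ** W ** transpose M = transpose M"
    "transpose (transpose M ** W) = transpose M ** W"
    using least_squares_inverse_exists by blast
  define Y where "Y = transpose W"
  have Y: "M ** Y ** M = M"
    using arg_cong[OF W(1), of transpose] by (simp add: Y_def matrix_transpose_mul matrix_mul_assoc)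
  have Y': "transpose (Y ** M) = Y ** M"
    using W(2) by (simp add: Y_def matrix_transpose_mul)
  define V where "V = Y ** M ** X"
  have MV: "M ** V = M ** X"
    using Y by (simp add: V_def matrix_mul_assoc)
  have "V ** M = Y ** (M ** X ** M)"
    by (simp add: V_def matrix_mul_assoc)
  then have VM: "V ** M = Y ** M"
    by (simp add: X(1))
  have "V ** M ** V = Y ** (M ** Y ** M) ** X"
    by (simp only: VM) (simp add: V_def matrix_mul_assoc)
  then have "V ** M ** V = V"
    by (simp add: Y V_def)
  then have "is_pinv M V"
    by (simp add: is_pinv_def MV VM X Y')
  then show ?thesis ..
qed

lemma is_pinv_unique:
  assumes "is_pinv M X" "is_pinv M Y"
  shows "X = Y"
proof -
  have "X = X ** (M ** Y ** M) ** X"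
    using assms by (simp add: is_pinv_def)
  also have "\<dots> = X ** (transpose (M ** X ** (M ** Y)))"
  proof -
    have "transpose (M ** X ** (M ** Y)) = transpose (M ** Y) ** transpose (M ** X)"
      by (rule matrix_transpose_mul)
    also have "\<dots> = M ** Y ** (M ** X)"
      using assms by (simp add: is_pinv_def)
    finally show ?thesis
      by (simp add: matrix_mul_assoc)
  qed
  also have "M ** X ** (M ** Y) = M ** Y"
    using assms by (simp add: is_pinv_def matrix_mul_assoc)
  also have "transpose (M ** Y) = M ** Y"
    using assms by (simp add: is_pinv_def)
  finally have 1: "X = X ** M ** Y"
    by (simp add: matrix_mul_assoc)
  have "Y = Y ** (M ** X ** M) ** Y"
    using assms by (simp add: is_pinv_def)
  also have "\<dots> = transpose (X ** M ** (Y ** M)) ** Y"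
  proof -
    have "transpose (X ** M ** (Y ** M)) = transpose (Y ** M) ** transpose (X ** M)"
      by (rule matrix_transpose_mul)
    also have "\<dots> = Y ** M ** (X ** M)"
      using assms by (simp add: is_pinv_def)
    finally show ?thesis
      by (simp add: matrix_mul_assoc)
  qed
  also have "X ** M ** (Y ** M) = X ** (M ** Y ** M)"
    by (simp add: matrix_mul_assoc)
  also have "M ** Y ** M = M"
    using assms by (simp add: is_pinv_def)
  also have "transpose (X ** M) = X ** M"
    using assms by (simp add: is_pinv_def)
  finally show ?thesis
    using 1 by simp
qed

lemma is_pinv_pinv: "is_pinv M (pinv M)"
  unfolding pinv_def using is_pinv_exists is_pinv_unique by (metis theI)

lemma pinv_gram_outside:
  assumes "i \<notin> S \<or> j \<notin> S"
  shows "pinv (transpose (cols A S) ** cols A S) $ i $ j = 0"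
proof -
  let ?M = "transpose (cols A S) ** cols A S"
  let ?X = "pinv ?M"
  have M0: "?M $ k $ l = 0" if "k \<notin> S \<or> l \<notin> S" for k l
    using that by (auto simp: matrix_matrix_mult_def transpose_def cols_def intro!: sum.neutral)
  have Mt: "transpose ?M = ?M"
    by (simp add: matrix_transpose_mul)
  have p: "?X ** ?M ** ?X = ?X" "transpose (?M ** ?X) = ?M ** ?X" "transpose (?X ** ?M) = ?X ** ?M"
    using is_pinv_pinv[of ?M] by (auto simp: is_pinv_def)
  have "transpose (?X ** ?M) = ?M ** transpose ?X"
    using matrix_transpose_mul[of ?X ?M] by (simp only: Mt)
  then have "?M ** transpose ?X = ?X ** ?M"
    using p(3) by (simp only:)
  then have "?X = ?M ** transpose ?X ** ?X"
    using p(1) by (simp only:)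
  then have "?X = ?M ** (transpose ?X ** ?X)"
    by (simp only: matrix_mul_assoc)
  moreover have "(?M ** B) $ i $ j = 0" if "i \<notin> S" for B :: "real^_^_"
    unfolding matrix_matrix_mult_def[of ?M B] using M0 that by simp
  moreover have "?X = (?X ** transpose ?X) ** ?M"
  proof -
    have "transpose (?M ** ?X) = transpose ?X ** ?M"
      using matrix_transpose_mul[of ?M ?X] by (simp only: Mt)
    then have "transpose ?X ** ?M = ?M ** ?X"
      using p(2) by (simp only:)
    moreover have "?X = ?X ** (?M ** ?X)"
      using p(1) by (simp only: matrix_mul_assoc)
    ultimately have "?X = ?X ** (transpose ?X ** ?M)"
      by (simp only:)
    then show ?thesis
      by (simp only: matrix_mul_assoc)
  qed
  moreover have "(B ** ?M) $ i $ j = 0" if "j \<notin> S" for B :: "real^_^_"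
    unfolding matrix_matrix_mult_def[of B ?M] using M0 that by simp
  ultimately show ?thesis
    using assms by metis
qed

section \<open>The lasso problem\<close>

definition l1 :: "real^'n \<Rightarrow> real" where
  "l1 u = (\<Sum>i\<in>UNIV. \<bar>u $ i\<bar>)"

definition lasso :: "real^'n^'m \<Rightarrow> real^'m \<Rightarrow> real \<Rightarrow> (real^'n) set" where
  "lasso A f t =
     (if t > 0
      then {u. is_arg_min (\<lambda>v. 1/2 * (norm (A *v v - f))\<^sup>2 + t * l1 v) (\<lambda>_. True) u}
      else {u. is_arg_min l1 (\<lambda>v. transpose A *v (A *v v - f) = 0) u})"

definition active :: "real^'n \<Rightarrow> 'n set" where
  "active u = {i. u $ i \<noteq> 0}"

definition equicorr :: "real^'n^'m \<Rightarrow> real^'m \<Rightarrow> real \<Rightarrow> real^'n \<Rightarrow> 'n set" where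
  "equicorr A f t u = {i. \<bar>column i A \<bullet> (A *v u - f)\<bar> = t}"

definition dual :: "real^'n^'m \<Rightarrow> real^'m \<Rightarrow> real \<Rightarrow> real^'n \<Rightarrow> real^'n" where
  "dual A f t u = (1/t) *\<^sub>R (transpose A *v (f - A *v u))"

text \<open>The breakpoint reached from the iterate u at t when moving in direction d.\<close>

definition next_t :: "real^'n^'m \<Rightarrow> real^'m \<Rightarrow> real \<Rightarrow> real^'n \<Rightarrow> real^'n \<Rightarrow> real" where
  "next_t A f t u d =
     (LEAST s. s \<in> {0..t} \<and> (\<forall>r\<in>{s..t}. u + (t - r) *\<^sub>R d \<in> lasso A f r))"

section \<open>The generalized homotopy method\<close>

definition gen_cand :: "real^'n^'m \<Rightarrow> real^'m \<Rightarrow> real \<Rightarrow> real^'n \<Rightarrow> (real^'n) set" where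
  "gen_cand A f t u =
     {d. is_arg_min (\<lambda>d. (norm (A *v d - (1/t) *\<^sub>R (f - A *v u)))\<^sup>2)
           (\<lambda>d. (\<forall>i. i \<notin> equicorr A f t u \<longrightarrow> d $ i = 0) \<and>
                (\<forall>i \<in> equicorr A f t u - active u. d $ i * dual A f t u $ i \<ge> 0)) d}"

definition gen_dir :: "real^'n^'m \<Rightarrow> real^'m \<Rightarrow> real \<Rightarrow> real^'n \<Rightarrow> real^'n" where
  "gen_dir A f t u = (THE d. is_arg_min norm (\<lambda>d. d \<in> gen_cand A f t u) d)"

text \<open>
  The recursions below are total; entries after a stop (or, for the standard method, after an
  error) are meaningless, and every notion further below only refers to entries before that.
\<close>

primrec gen_iter :: "real^'n^'m \<Rightarrow> real^'m \<Rightarrow> nat \<Rightarrow> real \<times> (real^'n)" where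
  "gen_iter A f 0 = (infnorm (transpose A *v f), 0)"
| "gen_iter A f (Suc j) =
     (let (t, u) = gen_iter A f j;
          d = gen_dir A f t u;
          t' = next_t A f t u d
      in (t', u + (t - t') *\<^sub>R d))"

definition gen_t :: "real^'n^'m \<Rightarrow> real^'m \<Rightarrow> nat \<Rightarrow> real" where
  "gen_t A f j = fst (gen_iter A f j)"

definition gen_u :: "real^'n^'m \<Rightarrow> real^'m \<Rightarrow> nat \<Rightarrow> real^'n" where
  "gen_u A f j = snd (gen_iter A f j)"

definition gen_stops :: "real^'n^'m \<Rightarrow> real^'m \<Rightarrow> nat \<Rightarrow> bool" where
  "gen_stops A f K \<longleftrightarrow> (\<forall>i<K. gen_t A f i \<noteq> 0) \<and> gen_t A f K = 0"

section \<open>The standard homotopy method\<close>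

definition std_dir :: "real^'n^'m \<Rightarrow> real^'m \<Rightarrow> 'n set \<Rightarrow> real \<Rightarrow> real^'n \<Rightarrow> real^'n" where
  "std_dir A f S t u =
     (\<chi> i. if i \<in> S
          then (pinv (transpose (cols A S) ** cols A S) *v subvec (dual A f t u) S) $ i
          else 0)"

text \<open>
  The first component of the state at iteration j is the active set of the previous iterate,
  which is empty for j = 0.
\<close>

primrec std_iter :: "real^'n^'m \<Rightarrow> real^'m \<Rightarrow> nat \<Rightarrow> 'n set \<times> real \<times> (real^'n)" where
  "std_iter A f 0 = ({}, infnorm (transpose A *v f), 0)"
| "std_iter A f (Suc j) =
     (let (B, t, u) = std_iter A f j;
          S = equicorr A f t u - (B - active u);
          d = std_dir A f S t u;
          t' = next_t A f t u d
      in (active u, t', u + (t - t') *\<^sub>R d))"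

definition std_t :: "real^'n^'m \<Rightarrow> real^'m \<Rightarrow> nat \<Rightarrow> real" where
  "std_t A f j = fst (snd (std_iter A f j))"

definition std_u :: "real^'n^'m \<Rightarrow> real^'m \<Rightarrow> nat \<Rightarrow> real^'n" where
  "std_u A f j = snd (snd (std_iter A f j))"

definition std_equi :: "real^'n^'m \<Rightarrow> real^'m \<Rightarrow> nat \<Rightarrow> 'n set" where
  "std_equi A f j = equicorr A f (std_t A f j) (std_u A f j)"

definition leav :: "real^'n^'m \<Rightarrow> real^'m \<Rightarrow> nat \<Rightarrow> 'n set" where
  "leav A f j =
     (case j of 0 \<Rightarrow> {} | Suc i \<Rightarrow> active (std_u A f i)) - active (std_u A f j)"

definition hit :: "real^'n^'m \<Rightarrow> real^'m \<Rightarrow> nat \<Rightarrow> 'n set" where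
  "hit A f j = std_equi A f j - (case j of 0 \<Rightarrow> {} | Suc i \<Rightarrow> std_equi A f i)"

text \<open>Iteration j is reached if no earlier iteration has stopped or reported an error.\<close>

definition std_reaches :: "real^'n^'m \<Rightarrow> real^'m \<Rightarrow> nat \<Rightarrow> bool" where
  "std_reaches A f j \<longleftrightarrow>
     (\<forall>i<j. std_t A f i \<noteq> 0 \<and> std_t A f (Suc i) \<noteq> std_t A f i)"

definition std_stops :: "real^'n^'m \<Rightarrow> real^'m \<Rightarrow> nat \<Rightarrow> bool" where
  "std_stops A f K \<longleftrightarrow> std_reaches A f K \<and> std_t A f K = 0"

definition one_at_a_time :: "real^'n^'m \<Rightarrow> real^'m \<Rightarrow> bool" where
  "one_at_a_time A f \<longleftrightarrow>
     (\<forall>j. std_reaches A f j \<and> std_t A f j > 0 \<longrightarrow> card (hit A f j \<union> leav A f j) \<le> 1)"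

text \<open>
  A coordinate that leaves at step j belongs to the equicorrelation set at step j. If it returns
  to the equicorrelation set at step j + 1 (with the opposite sign), it is therefore not in
  \<open>hit A f (Suc j)\<close>, and the one-at-a-time condition does not see this event. It can then
  coincide with another event, and the standard method can report an error: for the matrix
  with columns (2,1,0), (1,0,0), (0,-1/2,1) and f = (1,-1/2,-1/12), column 1 leaves at t = 1/2;
  at t = 1/6 it returns while column 3 hits, and the standard direction has the wrong sign in
  coordinate 3. If the method does not stop at all, no number of steps K exists, over which the
  one-at-a-time condition could range. The comparison of the outputs therefore presupposes either
  that K exists, or that such coincidences are excluded as follows; in the second case it is a
  consequence that the method stops without error.
\<close>

definition returns_alone :: "real^'n^'m \<Rightarrow> real^'m \<Rightarrow> bool" where
  "returns_alone A f \<longleftrightarrow>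
     (\<forall>j. std_reaches A f (Suc j) \<and> std_t A f (Suc j) > 0 \<and>
          leav A f j \<inter> std_equi A f (Suc j) \<noteq> {} \<longrightarrow>
          hit A f (Suc j) \<union> leav A f (Suc j) = {})"

end

theory Submission
  imports Defs
begin

text \<open>
  Under injectivity, a direction supported on the equicorrelation set that solves the lasso
  problem on an interval of positive length satisfies the optimality conditions of the constrained
  least squares problem of the generalized method. That problem has a unique solution, so as long
  as the standard method makes progress it moves in the generalized direction, and it remains to
  see that it stops without error if it is not assumed to stop.

  By the one-at-a-time condition at most one equicorrelated coordinate is inactive at a breakpoint:
  it has just hit, left, or returned. The difference e of the new and the old direction is then
  orthogonal, in the Gram inner product, to all other equicorrelated coordinates, so
  \<open>\<parallel>A e\<parallel>\<^sup>2\<close> is the product of the i-th entries of e and of \<open>A\<^sup>T A e\<close>. Positivity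
  of this product gives the signs that the optimality conditions require, even strictly, and the
  strictness carries the argument to the next breakpoint. Finally, no sign pattern occurs on two
  linear pieces, so there are finitely many pieces.
\<close>

text \<open>The sign is opposite to the one in \<open>equicorr\<close>, so that optimality at an
  active coordinate reads \<open>corr A f u i = t * sgn (u $ i)\<close> and \<open>dual\<close> is
  \<open>corr\<close> divided by t.\<close>

definition corr :: "real^'n^'m \<Rightarrow> real^'m \<Rightarrow> real^'n \<Rightarrow> 'n \<Rightarrow> real" where
  "corr A f u i = column i A \<bullet> (f - A *v u)"

text \<open>Stated for \<open>v*\<close> because the simplifier rewrites
  \<open>transpose A *v y\<close> to \<open>y v* A\<close>.\<close>

lemma vector_matrix_mult_nth: "(y v* A) $ i = column i A \<bullet> y"
  by (simp add: vector_matrix_mult_def column_def inner_vec_def mult.commute)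

lemma inner_mult_eq_sum: "(A *v d) \<bullet> y = (\<Sum>i\<in>UNIV. d $ i * (column i A \<bullet> y))"
proof -
  have "(A *v d) \<bullet> y = d \<bullet> (transpose A *v y)"
    by (metis dot_lmul_matrix inner_commute vector_transpose_matrix transpose_transpose)
  then show ?thesis
    by (simp add: inner_vec_def[of d] vector_matrix_mult_nth)
qed

lemma corr_move: "corr A f (u + x *\<^sub>R d) i = corr A f u i - x * (column i A \<bullet> (A *v d))"
  by (simp add: corr_def matrix_vector_right_distrib matrix_vector_mult_scaleR inner_diff_right
      inner_add_right)

lemma mem_equicorr_iff: "i \<in> equicorr A f t u \<longleftrightarrow> \<bar>corr A f u i\<bar> = t"
  by (simp add: equicorr_def corr_def inner_diff_right abs_minus_commute)

lemma dual_nth: "dual A f t u $ i = corr A f u i / t"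
  by (simp add: dual_def corr_def vector_matrix_mult_nth)

lemma abs_dual:
  assumes "t > 0" "i \<in> equicorr A f t u"
  shows "\<bar>dual A f t u $ i\<bar> = 1"
  using assms by (simp add: mem_equicorr_iff dual_nth)

lemma dual_square:
  assumes "t > 0" "i \<in> equicorr A f t u"
  shows "dual A f t u $ i * dual A f t u $ i = 1"
  using abs_dual[OF assms] by (auto simp: abs_if split: if_splits)

section \<open>Optimality conditions\<close>

text \<open>Let h decrease to 0. This extracts first-order conditions from inequalities that have
  been divided by h and keep a remainder linear in h.\<close>

lemma le_zero_if_le_small_multiples:
  fixes y k \<delta> :: real
  assumes "\<delta> > 0" "\<And>h. 0 < h \<Longrightarrow> h \<le> \<delta> \<Longrightarrow> y \<le> k * h"
  shows "y \<le> 0"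
proof (rule tendsto_lowerbound)
  show "((\<lambda>h. k * h) \<longlongrightarrow> 0) (at_right 0)"
    by (auto intro!: tendsto_eq_intros)
  show "\<forall>\<^sub>F h in at_right 0. y \<le> k * h"
    unfolding eventually_at_right_field using assms by (intro exI[of _ \<delta>]) auto
qed simp

text \<open>The hypothesis says that the lasso objective along one coordinate has its minimum at h =
  0. Dividing by h and letting h tend to 0 from either side removes the quadratic term.\<close>

lemma soft_threshold_optimality:
  fixes a c t x :: real
  assumes min: "\<And>h. a / 2 * h\<^sup>2 - h * c + t * (\<bar>x + h\<bar> - \<bar>x\<bar>) \<ge> 0" and t: "t > 0"
  shows "\<bar>c\<bar> \<le> t \<and> (x \<noteq> 0 \<longrightarrow> c = t * sgn x)"
proof (intro conjI impI)
  have bound: "h * c \<le> a / 2 * h\<^sup>2 + t * \<bar>h\<bar>" for h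
  proof -
    have "t * (\<bar>x + h\<bar> - \<bar>x\<bar>) \<le> t * \<bar>h\<bar>"
      using t by (intro mult_left_mono) auto
    then show ?thesis
      using min[of h] by linarith
  qed
  have 1: "c - t \<le> 0"
  proof (rule le_zero_if_le_small_multiples[of 1])
    fix h :: real assume "0 < h"
    have "h * c \<le> h * (a / 2 * h + t)"
      using bound[of h] \<open>0 < h\<close> by (simp add: power2_eq_square algebra_simps)
    then show "c - t \<le> a / 2 * h"
      using \<open>0 < h\<close> by simp
  qed simp
  have 2: "- c - t \<le> 0"
  proof (rule le_zero_if_le_small_multiples[of 1])
    fix h :: real assume "0 < h"
    have "h * (- c) \<le> h * (a / 2 * h + t)"
      using bound[of "- h"] \<open>0 < h\<close> by (simp add: power2_eq_square algebra_simps)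
    then show "- c - t \<le> a / 2 * h"
      using \<open>0 < h\<close> by (subst (asm) mult_le_cancel_left) auto
  qed simp
  show "\<bar>c\<bar> \<le> t"
    using 1 2 by linarith
next
  assume "x \<noteq> 0"
  have bound: "h * (c - t * sgn x) \<le> a / 2 * h\<^sup>2" if "\<bar>h\<bar> \<le> \<bar>x\<bar>" for h
  proof -
    \<comment> \<open>Within this range \<open>x + h\<close> does not cross zero, so the absolute
      value is linear there.\<close>
    have "\<bar>x + h\<bar> - \<bar>x\<bar> = h * sgn x"
      using that \<open>x \<noteq> 0\<close> by (auto simp: sgn_if abs_if split: if_splits)
    then show ?thesis
      using min[of h] by (simp add: algebra_simps)
  qed
  have 1: "c - t * sgn x \<le> 0"
  proof (rule le_zero_if_le_small_multiples[of "\<bar>x\<bar>"])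
    fix h :: real assume h: "0 < h" "h \<le> \<bar>x\<bar>"
    have "h * (c - t * sgn x) \<le> h * (a / 2 * h)"
      using bound[of h] h by (simp add: power2_eq_square algebra_simps)
    then show "c - t * sgn x \<le> a / 2 * h"
      using h by (subst (asm) mult_le_cancel_left) auto
  qed (use \<open>x \<noteq> 0\<close> in simp)
  have 2: "- (c - t * sgn x) \<le> 0"
  proof (rule le_zero_if_le_small_multiples[of "\<bar>x\<bar>"])
    fix h :: real assume h: "0 < h" "h \<le> \<bar>x\<bar>"
    have "h * (- (c - t * sgn x)) \<le> h * (a / 2 * h)"
      using bound[of "- h"] h by (simp add: power2_eq_square algebra_simps)
    then show "- (c - t * sgn x) \<le> a / 2 * h"
      using h by (subst (asm) mult_le_cancel_left) auto
  qed (use \<open>x \<noteq> 0\<close> in simp)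
  show "c = t * sgn x"
    using 1 2 by linarith
qed

text \<open>The hypotheses say that c is a subgradient of t times the absolute value at y.\<close>

lemma abs_subgradient:
  fixes c t x y :: real
  assumes "\<bar>c\<bar> \<le> t" "y \<noteq> 0 \<Longrightarrow> c = t * sgn y"
  shows "(x - y) * c \<le> t * \<bar>x\<bar> - t * \<bar>y\<bar>"
proof -
  have "x * c \<le> \<bar>x\<bar> * \<bar>c\<bar>"
    by (simp add: abs_mult[symmetric])
  also have "\<dots> \<le> \<bar>x\<bar> * t"
    using assms(1) by (intro mult_left_mono) auto
  finally have "x * c \<le> t * \<bar>x\<bar>"
    by (simp add: mult.commute)
  moreover have "y * c = t * \<bar>y\<bar>"
    using assms(2) by (cases "y = 0") (auto simp: abs_sgn)
  ultimately show ?thesis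
    by (simp add: left_diff_distrib)
qed

text \<open>The exact second-order expansion at u, with \<open>corr\<close> as the negative gradient
  of half the squared residual. It is used for the lasso and, with another target g, for the
  direction problem.\<close>

lemma square_norm_residual_diff:
  fixes g :: "real^'m"
  shows "(norm (A *v v - g))\<^sup>2 = (norm (A *v u - g))\<^sup>2 + (norm (A *v (v - u)))\<^sup>2
     - 2 * (\<Sum>i\<in>UNIV. (v - u) $ i * corr A g u i)"
proof -
  have "(A *v (v - u)) \<bullet> (g - A *v u) = (\<Sum>i\<in>UNIV. (v - u) $ i * corr A g u i)"
    by (simp only: inner_mult_eq_sum corr_def)
  moreover have "(norm (A *v v - g))\<^sup>2 = (norm (A *v u - g))\<^sup>2 + (norm (A *v (v - u)))\<^sup>2
     - 2 * ((A *v (v - u)) \<bullet> (g - A *v u))"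
    by (simp add: power2_norm_eq_inner matrix_vector_mult_diff_distrib inner_diff_left
        inner_diff_right inner_commute)
  ultimately show ?thesis
    by simp
qed

section \<open>Subgradient characterization of lasso solutions\<close>

lemma lasso_pos_iff:
  assumes "t > 0"
  shows "u \<in> lasso A f t \<longleftrightarrow>
    (\<forall>v. 1/2 * (norm (A *v u - f))\<^sup>2 + t * l1 u \<le> 1/2 * (norm (A *v v - f))\<^sup>2 + t * l1 v)"
  using assms by (auto simp: lasso_def is_arg_min_def not_less)

lemma lasso_zero_iff:
  "u \<in> lasso A f 0 \<longleftrightarrow> (\<forall>i. corr A f u i = 0) \<and>
    (\<forall>v. (\<forall>i. corr A f v i = 0) \<longrightarrow> l1 u \<le> l1 v)"
proof -
  have *: "transpose A *v (A *v v - f) = 0 \<longleftrightarrow> (\<forall>i. corr A f v i = 0)" for v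
    by (simp add: vec_eq_iff vector_matrix_mult_nth corr_def inner_diff_right algebra_simps eq_commute)
  show ?thesis
    unfolding lasso_def is_arg_min_def * by (auto simp: not_less)
qed

text \<open>Necessity follows from perturbing one coordinate at a time. For sufficiency the
  subgradient inequalities are summed over the coordinates and the nonnegative quadratic term of the
  expansion is dropped.\<close>

lemma lasso_iff:
  assumes t: "t > 0"
  shows "u \<in> lasso A f t \<longleftrightarrow>
    (\<forall>i. \<bar>corr A f u i\<bar> \<le> t \<and> (u $ i \<noteq> 0 \<longrightarrow> corr A f u i = t * sgn (u $ i)))"
proof
  assume u: "u \<in> lasso A f t"
  show "\<forall>i. \<bar>corr A f u i\<bar> \<le> t \<and> (u $ i \<noteq> 0 \<longrightarrow> corr A f u i = t * sgn (u $ i))"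
  proof
    fix i
    show "\<bar>corr A f u i\<bar> \<le> t \<and> (u $ i \<noteq> 0 \<longrightarrow> corr A f u i = t * sgn (u $ i))"
    proof (rule soft_threshold_optimality[OF _ t])
      fix h
      \<comment> \<open>Along this axis the objective changes as in
        \<open>soft_threshold_optimality\<close>, with a the squared norm of column i.\<close>
      define v where "v = u + h *\<^sub>R axis i 1"
      have "l1 v = \<bar>u $ i + h\<bar> + (\<Sum>k\<in>UNIV - {i}. \<bar>v $ k\<bar>)"
        unfolding l1_def by (subst sum.remove[of UNIV i]) (auto simp: v_def axis_def)
      also have "(\<Sum>k\<in>UNIV - {i}. \<bar>v $ k\<bar>) = (\<Sum>k\<in>UNIV - {i}. \<bar>u $ k\<bar>)"
        by (rule sum.cong) (auto simp: v_def axis_def)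
      also have "\<dots> = l1 u - \<bar>u $ i\<bar>"
        unfolding l1_def by (subst sum.remove[of UNIV i]) auto
      finally have l: "l1 v - l1 u = \<bar>u $ i + h\<bar> - \<bar>u $ i\<bar>"
        by simp
      have "(\<Sum>k\<in>UNIV. (v - u) $ k * corr A f u k) = h * corr A f u i"
        by (subst sum.remove[of UNIV i]) (auto simp: v_def axis_def)
      moreover have "(norm (A *v (v - u)))\<^sup>2 = (norm (A *v axis i 1))\<^sup>2 * h\<^sup>2"
        by (simp add: v_def matrix_vector_mult_scaleR power_mult_distrib)
      ultimately have n: "(norm (A *v v - f))\<^sup>2 =
          (norm (A *v u - f))\<^sup>2 + (norm (A *v axis i 1))\<^sup>2 * h\<^sup>2 - 2 * (h * corr A f u i)"
        by (simp add: square_norm_residual_diff[of A v f u])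
      have "1/2 * (norm (A *v u - f))\<^sup>2 + t * l1 u \<le> 1/2 * (norm (A *v v - f))\<^sup>2 + t * l1 v"
        using u t by (simp add: lasso_pos_iff)
      moreover have "t * (l1 v - l1 u) = t * l1 v - t * l1 u"
        by (simp add: algebra_simps)
      ultimately show "(norm (A *v axis i 1))\<^sup>2 / 2 * h\<^sup>2 - h * corr A f u i +
          t * (\<bar>u $ i + h\<bar> - \<bar>u $ i\<bar>) \<ge> 0"
        unfolding n l[symmetric] by (simp add: field_simps)
    qed
  qed
next
  assume K: "\<forall>i. \<bar>corr A f u i\<bar> \<le> t \<and> (u $ i \<noteq> 0 \<longrightarrow> corr A f u i = t * sgn (u $ i))"
  show "u \<in> lasso A f t"
    unfolding lasso_pos_iff[OF t]
  proof
    fix v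
    have "(v - u) $ i * corr A f u i \<le> t * \<bar>v $ i\<bar> - t * \<bar>u $ i\<bar>" for i
      using K abs_subgradient[of "corr A f u i" t "u $ i" "v $ i"] by simp
    then have "(\<Sum>i\<in>UNIV. (v - u) $ i * corr A f u i) \<le> (\<Sum>i\<in>UNIV. t * \<bar>v $ i\<bar> - t * \<bar>u $ i\<bar>)"
      by (rule sum_mono)
    also have "\<dots> = t * l1 v - t * l1 u"
      by (simp add: l1_def sum_subtractf sum_distrib_left)
    finally show "1/2 * (norm (A *v u - f))\<^sup>2 + t * l1 u \<le> 1/2 * (norm (A *v v - f))\<^sup>2 + t * l1 v"
      using square_norm_residual_diff[of A v f u] zero_le_power2[of "norm (A *v (v - u))"]
      by linarith
  qed
qed

section \<open>Consequences of optimality for signs, supports and the fit\<close>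

lemma lasso_corr_le:
  assumes "t > 0" "u \<in> lasso A f t"
  shows "\<bar>corr A f u i\<bar> \<le> t"
  using assms lasso_iff by blast

lemma lasso_corr_active:
  assumes "t > 0" "u \<in> lasso A f t" "u $ i \<noteq> 0"
  shows "corr A f u i = t * sgn (u $ i)"
  using assms lasso_iff by blast

lemma active_subset_equicorr:
  assumes "t > 0" "u \<in> lasso A f t"
  shows "active u \<subseteq> equicorr A f t u"
  using assms by (auto simp: active_def mem_equicorr_iff lasso_corr_active abs_mult)

lemma dual_active:
  assumes "t > 0" "u \<in> lasso A f t" "u $ i \<noteq> 0"
  shows "dual A f t u $ i = sgn (u $ i)"
  using assms by (simp add: dual_nth lasso_corr_active)

text \<open>Monotonicity of the subdifferential: adding the subgradient inequalities at u and at v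
  cancels the l1 terms and leaves a nonpositive bound for the squared norm of
  \<open>A *v (u - v)\<close>.\<close>

lemma lasso_fit_unique:
  fixes A :: "real^'n^'m"
  assumes t: "t > 0" and u: "u \<in> lasso A f t" and v: "v \<in> lasso A f t"
  shows "A *v u = A *v v"
proof -
  have *: "(x - y) $ i * corr A f y i \<le> t * \<bar>x $ i\<bar> - t * \<bar>y $ i\<bar>"
    if "y \<in> lasso A f t" for x y :: "real^'n" and i
    using abs_subgradient[OF lasso_corr_le[OF t that] lasso_corr_active[OF t that]] by simp
  have "(A *v (u - v)) \<bullet> (A *v (u - v)) =
      (\<Sum>i\<in>UNIV. (u - v) $ i * (column i A \<bullet> (A *v (u - v))))"
    by (rule inner_mult_eq_sum)
  also have "\<dots> = (\<Sum>i\<in>UNIV. (u - v) $ i * corr A f v i + (v - u) $ i * corr A f u i)"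
    by (rule sum.cong)
      (auto simp: corr_def matrix_vector_mult_diff_distrib inner_diff_right algebra_simps)
  also have "\<dots> \<le> 0"
  proof (rule sum_nonpos)
    show "(u - v) $ i * corr A f v i + (v - u) $ i * corr A f u i \<le> 0" for i
      using *[OF u, of v i] *[OF v, of u i] by linarith
  qed
  finally have "A *v (u - v) = 0"
    by (metis inner_gt_zero_iff not_less)
  then show ?thesis
    by (simp add: matrix_vector_mult_diff_distrib)
qed

section \<open>Linear pieces of the solution path\<close>

text \<open>Solutions of the normal equations are exactly the competitors in the problem at t = 0;
  here the linear term of the expansion vanishes.\<close>

lemma corr_zero_residual_minimal:
  assumes "\<forall>i. corr A f v i = 0"
  shows "(norm (A *v v - f))\<^sup>2 \<le> (norm (A *v u - f))\<^sup>2"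
  using square_norm_residual_diff[of A u f v] assms by simp

lemma continuous_l1 [continuous_intros]:
  "continuous_on S g \<Longrightarrow> continuous_on S (\<lambda>x. l1 (g x))"
  unfolding l1_def by (intro continuous_intros)

text \<open>For s > 0 the minimality inequality passes to the limit. At s = 0 the bound r on the
  correlations yields the normal equations, and a competitor v that solves them has the least
  residual, so minimality at r > 0 already forces \<open>l1 (q r) \<le> l1 v\<close>.\<close>

lemma lasso_right_limit:
  fixes q :: "real \<Rightarrow> real^'n"
  assumes "0 \<le> s" "s < t" and sol: "\<And>r. s < r \<Longrightarrow> r \<le> t \<Longrightarrow> q r \<in> lasso A f r"
    and q: "continuous_on UNIV q"
  shows "q s \<in> lasso A f s"
proof -
  have lim: "(g \<longlongrightarrow> g s) (at_right s)" if "continuous_on UNIV g" for g :: "real \<Rightarrow> real"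
    using that by (simp add: continuous_on_eq_continuous_within isCont_def filterlim_at_split)
  have Aq: "continuous_on UNIV (\<lambda>r. A *v q r)"
    using q by (rule continuous_on_compose2[OF matrix_vector_mult_linear_continuous_on]) auto
  have ev: "\<forall>\<^sub>F r in at_right s. P r" if "\<And>r. s < r \<Longrightarrow> r \<le> t \<Longrightarrow> P r" for P
    unfolding eventually_at_right_field using that \<open>s < t\<close> by (intro exI[of _ t]) auto
  have le: "g s \<le> h s" if "continuous_on UNIV g" "continuous_on UNIV h"
    "\<And>r. s < r \<Longrightarrow> r \<le> t \<Longrightarrow> g r \<le> h r" for g h :: "real \<Rightarrow> real"
    by (rule tendsto_le[OF _ lim lim ev]) (use that in auto)
  show ?thesis
  proof (cases "s = 0")
    case False
    then have s: "s > 0"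
      using assms by simp
    show ?thesis
      unfolding lasso_pos_iff[OF s]
    proof
      fix v
      show "1/2 * (norm (A *v q s - f))\<^sup>2 + s * l1 (q s) \<le> 1/2 * (norm (A *v v - f))\<^sup>2 + s * l1 v"
      proof (rule le)
        show "1/2 * (norm (A *v q r - f))\<^sup>2 + r * l1 (q r) \<le> 1/2 * (norm (A *v v - f))\<^sup>2 + r * l1 v"
          if "s < r" "r \<le> t" for r
          using sol[OF that] that s by (simp add: lasso_pos_iff)
      qed (intro continuous_intros Aq q)+
    qed
  next
    case True
    have "\<bar>corr A f (q s) i\<bar> \<le> s" for i
    proof (rule le[where h = "\<lambda>r. r"])
      show "\<bar>corr A f (q r) i\<bar> \<le> r" if "s < r" "r \<le> t" for r
        using sol[OF that] that True by (simp add: lasso_corr_le)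
      show "continuous_on UNIV (\<lambda>r. \<bar>corr A f (q r) i\<bar>)"
        unfolding corr_def by (intro continuous_intros Aq)
    qed (intro continuous_intros)
    moreover have "l1 (q s) \<le> l1 v" if v: "\<forall>i. corr A f v i = 0" for v
    proof (rule le[where g = "\<lambda>r. l1 (q r)" and h = "\<lambda>_. l1 v"])
      show "l1 (q r) \<le> l1 v" if "s < r" "r \<le> t" for r
      proof -
        have "1/2 * (norm (A *v q r - f))\<^sup>2 + r * l1 (q r) \<le> 1/2 * (norm (A *v v - f))\<^sup>2 + r * l1 v"
          using sol[OF that] that True by (simp add: lasso_pos_iff)
        then have "r * l1 (q r) \<le> r * l1 v"
          using corr_zero_residual_minimal[OF v, of "q r"] by linarith
        then show ?thesis
          using that True by simp
      qed
    qed (intro continuous_intros q)+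
    ultimately show ?thesis
      using True by (simp add: lasso_zero_iff)
  qed
qed

text \<open>\<open>LEAST\<close> over the reals is meaningful only if the minimum is attained. The
  admissible set contains t and is bounded below by 0, and \<open>lasso_right_limit\<close> puts its
  infimum into it.\<close>

lemma next_t:
  assumes u: "u \<in> lasso A f t" and t: "0 \<le> t"
  shows next_t_nonneg: "0 \<le> next_t A f t u d" and next_t_le: "next_t A f t u d \<le> t"
    and next_t_path: "\<And>r. next_t A f t u d \<le> r \<Longrightarrow> r \<le> t \<Longrightarrow> u + (t - r) *\<^sub>R d \<in> lasso A f r"
    and next_t_least: "\<And>s. 0 \<le> s \<Longrightarrow> s \<le> t \<Longrightarrow>
      (\<And>r. s \<le> r \<Longrightarrow> r \<le> t \<Longrightarrow> u + (t - r) *\<^sub>R d \<in> lasso A f r) \<Longrightarrow> next_t A f t u d \<le> s"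
proof -
  define T where "T = {s. s \<in> {0..t} \<and> (\<forall>r\<in>{s..t}. u + (t - r) *\<^sub>R d \<in> lasso A f r)}"
  have tT: "t \<in> T"
    using u t by (auto simp: T_def)
  have bdd: "bdd_below T"
    by (rule bdd_belowI[of _ 0]) (auto simp: T_def)
  define s where "s = Inf T"
  have s_le: "s \<le> y" if "y \<in> T" for y
    unfolding s_def using bdd that by (rule cInf_lower[rotated])
  have s0: "0 \<le> s"
    unfolding s_def using tT by (intro cInf_greatest) (auto simp: T_def)
  have after: "u + (t - r) *\<^sub>R d \<in> lasso A f r" if "s < r" "r \<le> t" for r
  proof -
    obtain y where "y \<in> T" "y < r"
      using \<open>s < r\<close> tT bdd cInf_less_iff[of T r] unfolding s_def by blast
    then show ?thesis
      using that by (auto simp: T_def)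
  qed
  have "u + (t - s) *\<^sub>R d \<in> lasso A f s"
  proof (cases "s = t")
    case False
    then have "s < t"
      using s_le[OF tT] by simp
    moreover have "continuous_on UNIV (\<lambda>r. u + (t - r) *\<^sub>R d)"
      by (intro continuous_intros)
    ultimately show ?thesis
      using lasso_right_limit[of s t "\<lambda>r. u + (t - r) *\<^sub>R d" A f] s0 after by blast
  qed (use u in simp)
  then have "u + (t - r) *\<^sub>R d \<in> lasso A f r" if "s \<le> r" "r \<le> t" for r
    using after[of r] that by (cases "r = s") auto
  then have "s \<in> T"
    using s0 s_le[OF tT] unfolding T_def by simp
  have n: "next_t A f t u d = s"
    unfolding next_t_def
  proof (rule Least_equality)
    show "s \<le> y" if "y \<in> {0..t} \<and> (\<forall>r\<in>{y..t}. u + (t - r) *\<^sub>R d \<in> lasso A f r)" for y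
      using s_le[of y] that by (simp add: T_def)
  qed (use \<open>s \<in> T\<close> in \<open>simp add: T_def\<close>)
  show "0 \<le> next_t A f t u d" "next_t A f t u d \<le> t"
    unfolding n by (fact s0, fact s_le[OF tT])
  show "u + (t - r) *\<^sub>R d \<in> lasso A f r" if "next_t A f t u d \<le> r" "r \<le> t" for r
    using that \<open>s \<in> T\<close> unfolding n T_def by simp
  show "next_t A f t u d \<le> s'" if "0 \<le> s'" "s' \<le> t"
    "\<And>r. s' \<le> r \<Longrightarrow> r \<le> t \<Longrightarrow> u + (t - r) *\<^sub>R d \<in> lasso A f r" for s'
    using s_le[of s'] that by (simp add: n T_def)
qed

text \<open>The initial parameter is the largest absolute correlation at 0. If it vanishes, 0 solves
  the normal equations and has the smallest possible l1 norm.\<close>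

lemma zero_in_lasso: "0 \<in> lasso A f (infnorm (transpose A *v f))"
proof -
  have le: "\<bar>corr A f 0 i\<bar> \<le> infnorm (transpose A *v f)" for i
    using component_le_infnorm_cart[of "transpose A *v f" i]
    by (simp add: corr_def vector_matrix_mult_nth)
  show ?thesis
  proof (cases "infnorm (transpose A *v f) = 0")
    case True
    then show ?thesis
      using le by (auto simp: lasso_zero_iff l1_def intro!: sum_nonneg)
  next
    case False
    then have "infnorm (transpose A *v f) > 0"
      using infnorm_pos_le[of "transpose A *v f"] by linarith
    then show ?thesis
      using le by (simp add: lasso_iff)
  qed
qed

section \<open>Optimal directions\<close>

text \<open>The optimality conditions of the least squares problem that defines \<open>gen_cand\<close>.\<close>

definition kkt_dir :: "real^'n^'m \<Rightarrow> real^'m \<Rightarrow> real \<Rightarrow> real^'n \<Rightarrow> real^'n \<Rightarrow> bool" where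
  "kkt_dir A f t u d \<longleftrightarrow> d \<in> supported (equicorr A f t u) \<and>
     (\<forall>i\<in>active u. column i A \<bullet> (A *v d) = dual A f t u $ i) \<and>
     (\<forall>i\<in>equicorr A f t u - active u.
        d $ i * dual A f t u $ i \<ge> 0 \<and> dual A f t u $ i * (column i A \<bullet> (A *v d)) \<ge> 1 \<and>
        (d $ i \<noteq> 0 \<longrightarrow> column i A \<bullet> (A *v d) = dual A f t u $ i))"

text \<open>The conditions make the linear term of the expansion at d favourable for every feasible
  v, so the excess of v is at least the squared norm of \<open>A *v (v - d)\<close>. Injectivity
  then leaves d as the only minimizer, and the minimal-norm choice has a single candidate.\<close>

lemma kkt_dir_eq_gen_dir:
  fixes A :: "real^'n^'m"
  assumes t: "t > 0" and kkt: "kkt_dir A f t u d"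
    and inj: "\<And>x. x \<in> supported (equicorr A f t u) \<Longrightarrow> A *v x = 0 \<Longrightarrow> x = 0"
  shows "gen_dir A f t u = d"
proof -
  let ?E = "equicorr A f t u" and ?p = "dual A f t u"
  define g where "g = (1/t) *\<^sub>R (f - A *v u)"
  define C where "C = {d. (\<forall>i. i \<notin> ?E \<longrightarrow> d $ i = 0) \<and> (\<forall>i\<in>?E - active u. d $ i * ?p $ i \<ge> 0)}"
  have cand: "gen_cand A f t u = {d. is_arg_min (\<lambda>d. (norm (A *v d - g))\<^sup>2) (\<lambda>d. d \<in> C) d}"
    by (simp add: gen_cand_def C_def g_def)
  have corr_g: "corr A g x i = ?p $ i - column i A \<bullet> (A *v x)" for x i
    by (simp add: corr_def g_def dual_nth inner_diff_right diff_divide_distrib)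
  have dC: "d \<in> C"
    using kkt by (auto simp: kkt_dir_def C_def supported_def)
  have gap: "(norm (A *v d - g))\<^sup>2 + (norm (A *v (v - d)))\<^sup>2 \<le> (norm (A *v v - g))\<^sup>2"
    if v: "v \<in> C" for v
  proof -
    have "(v - d) $ i * corr A g d i \<le> 0" for i
    proof -
      let ?b = "column i A \<bullet> (A *v d)"
      consider "i \<notin> ?E" | "i \<in> active u" | "i \<in> ?E - active u" "d $ i \<noteq> 0"
        | "i \<in> ?E - active u" "d $ i = 0"
        by blast
      then show ?thesis
      proof cases
        case 1
        then show ?thesis
          using v dC by (simp add: C_def)
      next
        case 4
        have pp: "?p $ i * ?p $ i = 1"
          using t 4 by (intro dual_square) auto
        \<comment> \<open>Since \<open>?p $ i\<close> is a sign, inserting its square splits the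
          product into the feasibility factor of v and the dual factor of d.\<close>
        have "v $ i * (?p $ i - ?b) = (v $ i * ?p $ i) * (1 - ?p $ i * ?b)"
          using pp by algebra
        moreover have "v $ i * ?p $ i \<ge> 0" "1 - ?p $ i * ?b \<le> 0"
          using v 4 kkt by (auto simp: C_def kkt_dir_def)
        ultimately have "v $ i * (?p $ i - ?b) \<le> 0"
          by (metis mult_nonneg_nonpos)
        then show ?thesis
          using 4 by (simp add: corr_g)
      qed (use kkt in \<open>auto simp: kkt_dir_def corr_g\<close>)
    qed
    then have "(\<Sum>i\<in>UNIV. (v - d) $ i * corr A g d i) \<le> 0"
      by (simp add: sum_nonpos)
    then show ?thesis
      using square_norm_residual_diff[of A v g d] by linarith
  qed
  have "(norm (A *v d - g))\<^sup>2 \<le> (norm (A *v v - g))\<^sup>2" if "v \<in> C" for v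
    using gap[OF that] zero_le_power2[of "norm (A *v (v - d))"] by linarith
  then have "is_arg_min (\<lambda>d. (norm (A *v d - g))\<^sup>2) (\<lambda>d. d \<in> C) d"
    using dC by (auto simp: is_arg_min_def not_less)
  moreover have "v = d" if "is_arg_min (\<lambda>d. (norm (A *v d - g))\<^sup>2) (\<lambda>d. d \<in> C) v" for v
  proof -
    have vC: "v \<in> C" and "(norm (A *v v - g))\<^sup>2 \<le> (norm (A *v d - g))\<^sup>2"
      using that dC by (auto simp: is_arg_min_def not_less)
    then have "(norm (A *v (v - d)))\<^sup>2 \<le> 0"
      using gap[OF vC] by linarith
    then have "A *v (v - d) = 0"
      by simp
    moreover have "v - d \<in> supported ?E"
      using vC dC by (auto simp: C_def supported_def)
    ultimately show ?thesis
      using inj by force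
  qed
  ultimately have "gen_cand A f t u = {d}"
    unfolding cand by blast
  then show ?thesis
    by (simp add: gen_dir_def is_arg_min_def cong: conj_cong)
qed

text \<open>Along the path each correlation is affine in r. Where the solution is nonzero it must
  equal r times a sign, which fixes its slope; elsewhere its absolute value must fall at least as
  fast as r.\<close>

lemma progress_imp_kkt_dir:
  assumes s: "0 \<le> s" "s < t" and u: "u \<in> lasso A f t"
    and d: "d \<in> supported (equicorr A f t u)"
    and path: "\<And>r. s \<le> r \<Longrightarrow> r \<le> t \<Longrightarrow> u + (t - r) *\<^sub>R d \<in> lasso A f r"
  shows "kkt_dir A f t u d"
  unfolding kkt_dir_def
proof (intro conjI ballI impI)
  let ?p = "dual A f t u"
  let ?b = "\<lambda>i. column i A \<bullet> (A *v d)"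
  have t: "t > 0"
    using s by simp
  have corr: "corr A f (u + (t - r) *\<^sub>R d) i = t * ?p $ i - (t - r) * ?b i" for r i
    using t by (simp add: corr_move dual_nth)
  have follow: "t * ?p $ i - (t - r) * ?b i = r * sgn ((u + (t - r) *\<^sub>R d) $ i)"
    if "s < r" "r \<le> t" "(u + (t - r) *\<^sub>R d) $ i \<noteq> 0" for r i
    using lasso_corr_active[OF _ path that(3)] that s corr by force
  show "d \<in> supported (equicorr A f t u)"
    by (fact d)
  show "?b i = ?p $ i" if "i \<in> active u" for i
  proof -
    have ui: "u $ i \<noteq> 0"
      using that by (simp add: active_def)
    \<comment> \<open>A step so short that coordinate i keeps its sign and \<open>t - x\<close>
      stays above s.\<close>
    define x where "x = min ((t - s) / 2) (\<bar>u $ i\<bar> / (2 * (1 + \<bar>d $ i\<bar>)))"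
    have x: "0 < x" "x \<le> (t - s) / 2" "x \<le> \<bar>u $ i\<bar> / (2 * (1 + \<bar>d $ i\<bar>))"
      using s ui unfolding x_def
      by (auto simp del: divide_le_eq_numeral1 le_divide_eq_numeral1 intro!: divide_pos_pos)
    have "x * (2 * (1 + \<bar>d $ i\<bar>)) \<le> \<bar>u $ i\<bar>"
      using x(3) by (subst (asm) pos_le_divide_eq) auto
    then have "\<bar>x * d $ i\<bar> < \<bar>u $ i\<bar>"
      using x(1) mult_nonneg_nonneg[of x "\<bar>d $ i\<bar>"]
      by (simp add: abs_mult algebra_simps)
    then have sg: "sgn (u $ i + x * d $ i) = sgn (u $ i)" "u $ i + x * d $ i \<noteq> 0"
      using ui by (auto simp: sgn_if)
    have "t * ?p $ i - x * ?b i = (t - x) * ?p $ i"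
      using follow[of "t - x" i] x s sg dual_active[OF t u ui] by simp
    then have "x * ?b i = x * ?p $ i"
      by (simp only: left_diff_distrib)
    then show ?thesis
      using x by (metis less_irrefl mult_cancel_left)
  qed
  fix i assume i: "i \<in> equicorr A f t u - active u"
  then have ui: "u $ i = 0"
    by (simp add: active_def)
  have pp: "?p $ i * ?p $ i = 1"
    using i t by (intro dual_square) auto
  have nonzero: "?b i = ?p $ i \<and> ?p $ i = sgn (d $ i)" if di: "d $ i \<noteq> 0"
  proof -
    have *: "t * ?p $ i - (t - r) * ?b i = r * sgn (d $ i)" if "s < r" "r < t" for r
      using follow[of r i] that di ui by (simp add: sgn_mult)
    obtain r1 r2 where r: "s < r1" "r1 < r2" "r2 < t"
      using s by (meson dense)
    \<comment> \<open>Subtracting the relations at two parameters eliminates the constant term and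
      leaves the slope; one relation then gives the constant term.\<close>
    have "(r2 - r1) * ?b i = (r2 - r1) * sgn (d $ i)"
      using *[of r1] *[of r2] r by (simp add: algebra_simps)
    then have b: "?b i = sgn (d $ i)"
      using r by simp
    have "t * ?p $ i = t * sgn (d $ i)"
      using *[of r1] r unfolding b by (simp add: algebra_simps)
    then show ?thesis
      using t b by simp
  qed
  show "?b i = ?p $ i" if "d $ i \<noteq> 0"
    using nonzero that by blast
  show "d $ i * ?p $ i \<ge> 0"
    using nonzero by (cases "d $ i = 0") (auto simp: sgn_if)
  obtain r where r: "s < r" "r < t"
    using s dense by blast
  have "\<bar>?p $ i * (t * ?p $ i - (t - r) * ?b i)\<bar> \<le> r"
    using lasso_corr_le[OF _ path, of r i] r s i abs_dual[OF t, of i A f u]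
    by (simp add: abs_mult corr)
  moreover have "?p $ i * (t * ?p $ i - (t - r) * ?b i) = t - (t - r) * (?p $ i * ?b i)"
    using pp by algebra
  ultimately have "t - r \<le> (t - r) * (?p $ i * ?b i)"
    by linarith
  then show "1 \<le> ?p $ i * ?b i"
    using r by simp
qed

text \<open>Each coordinate satisfies its optimality condition for r slightly below t, and there are
  finitely many. Coordinates outside the equicorrelation set have slack, active ones keep their
  sign, entering ones have correlation exactly r times the sign of d, and those staying at 0 lose
  correlation at least as fast as r.\<close>

lemma kkt_dir_imp_progress:
  fixes A :: "real^'n^'m"
  assumes t: "t > 0" and u: "u \<in> lasso A f t" and kkt: "kkt_dir A f t u d"
  shows "next_t A f t u d < t"
proof -
  let ?p = "dual A f t u"
  let ?b = "\<lambda>i. column i A \<bullet> (A *v d)"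
  let ?q = "\<lambda>r. u + (t - r) *\<^sub>R d"
  let ?ok = "\<lambda>r i. \<bar>corr A f (?q r) i\<bar> \<le> r \<and>
    (?q r $ i \<noteq> 0 \<longrightarrow> corr A f (?q r) i = r * sgn (?q r $ i))"
  have corr: "corr A f (?q r) i = t * ?p $ i - (t - r) * ?b i" for r i
    using t by (simp add: corr_move dual_nth)
  have near: "\<forall>\<^sub>F r in at_left t. r < t \<and> 0 < r"
    unfolding eventually_at_left_field using t by (intro exI[of _ 0]) auto
  have pos: "\<forall>\<^sub>F r in at_left t. 0 < g r" if "(g \<longlongrightarrow> l) (at_left t)" "0 < l" for g and l :: real
    using that by (rule order_tendstoD)
  have "\<forall>\<^sub>F r in at_left t. ?ok r i" for i
  proof -
    consider "i \<notin> equicorr A f t u" | "i \<in> active u"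
      | "i \<in> equicorr A f t u - active u" "d $ i \<noteq> 0"
      | "i \<in> equicorr A f t u - active u" "d $ i = 0"
      by blast
    then show ?thesis
    proof cases
      case 1
      then have "\<bar>corr A f u i\<bar> < t"
        using lasso_corr_le[OF t u, of i] by (auto simp: mem_equicorr_iff)
      then have "0 < t - \<bar>t * ?p $ i\<bar>"
        using t by (simp add: dual_nth)
      then have "\<forall>\<^sub>F r in at_left t. 0 < r - \<bar>t * ?p $ i - (t - r) * ?b i\<bar>"
        by (rule pos[rotated]) (auto intro!: tendsto_eq_intros)
      moreover have "u $ i = 0" "d $ i = 0"
        using 1 kkt active_subset_equicorr[OF t u] by (auto simp: active_def kkt_dir_def supported_def)
      ultimately show ?thesis
        by (auto simp: corr elim: eventually_mono)
    next
      case 2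
      then have ui: "u $ i \<noteq> 0" and b: "?b i = ?p $ i"
        using kkt by (auto simp: active_def kkt_dir_def)
      have "\<forall>\<^sub>F r in at_left t. 0 < \<bar>u $ i\<bar> - \<bar>(t - r) * d $ i\<bar>"
        using ui by (intro pos[where l = "\<bar>u $ i\<bar>"]) (auto intro!: tendsto_eq_intros)
      then show ?thesis
        using near
      proof eventually_elim
        case (elim r)
        then have "sgn (?q r $ i) = sgn (u $ i)"
          using ui by (auto simp: sgn_if)
        moreover have "corr A f (?q r) i = r * sgn (u $ i)"
          unfolding corr b dual_active[OF t u ui] by (simp add: algebra_simps)
        ultimately show ?case
          using elim ui by (simp add: abs_mult)
      qed
    next
      case 3
      then have ui: "u $ i = 0" and b: "?b i = ?p $ i" and "d $ i * ?p $ i \<ge> 0"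
        using kkt by (auto simp: active_def kkt_dir_def)
      moreover have "\<bar>?p $ i\<bar> = 1"
        using t 3 by (intro abs_dual) auto
      ultimately have p: "?p $ i = sgn (d $ i)"
        using 3 by (auto simp: sgn_if abs_if zero_le_mult_iff split: if_splits)
      show ?thesis
        using near
      proof eventually_elim
        case (elim r)
        have "corr A f (?q r) i = r * sgn (d $ i)"
          unfolding corr b p by (simp add: algebra_simps)
        then show ?case
          using elim ui 3 by (simp add: abs_mult sgn_mult)
      qed
    next
      case 4
      then have ui: "u $ i = 0" and b: "?p $ i * ?b i \<ge> 1"
        using kkt by (auto simp: active_def kkt_dir_def)
      have p: "\<bar>?p $ i\<bar> = 1" "?p $ i * ?p $ i = 1"
        using t 4 abs_dual dual_square by auto
      have "\<forall>\<^sub>F r in at_left t. 0 < t - (t - r) * (?p $ i * ?b i) + r"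
        using t by (intro pos[where l = "t + t"]) (auto intro!: tendsto_eq_intros)
      then show ?thesis
        using near
      proof eventually_elim
        case (elim r)
        \<comment> \<open>y is the loss of signed correlation: \<open>t - r \<le> y\<close> keeps it
          below r, and closeness of r to t prevents it from passing below -r.\<close>
        define y where "y = (t - r) * (?p $ i * ?b i)"
        have "?p $ i * corr A f (?q r) i = t - y"
          unfolding corr y_def using p(2) by algebra
        moreover have "t - r \<le> y"
          unfolding y_def using mult_left_mono[OF b, of "t - r"] elim by simp
        moreover have "0 < t - y + r"
          unfolding y_def using elim by blast
        ultimately have "\<bar>?p $ i * corr A f (?q r) i\<bar> \<le> r"
          by linarith
        then show ?case
          using ui 4 p by (simp add: abs_mult)
      qed
    qed
  qed
  then have "\<forall>\<^sub>F r in at_left t. \<forall>i. ?ok r i"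
    by (rule eventually_all_finite)
  then have "\<forall>\<^sub>F r in at_left t. ?q r \<in> lasso A f r"
    using near by eventually_elim (simp add: lasso_iff)
  then obtain s where s: "s < t" "\<And>r. s < r \<Longrightarrow> r < t \<Longrightarrow> ?q r \<in> lasso A f r"
    unfolding eventually_at_left_field by blast
  \<comment> \<open>The maximum keeps the point nonnegative; the midpoint is strictly above s, as
    the solution property is known only on the open interval.\<close>
  define s' where "s' = (max s 0 + t) / 2"
  have s': "0 \<le> s'" "s < s'" "s' < t"
    using s t by (auto simp: s'_def)
  have "next_t A f t u d \<le> s'"
  proof (rule next_t_least[OF u])
    show "?q r \<in> lasso A f r" if "s' \<le> r" "r \<le> t" for r
      using s(2)[of r] s' that u by (cases "r = t") auto
  qed (use t s' in auto)
  then show ?thesis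
    using s' by simp
qed

section \<open>The standard direction\<close>

lemma cols_mult_supported:
  assumes "x \<in> supported S"
  shows "cols A S *v x = A *v x"
  using assms unfolding matrix_vector_mult_def cols_def supported_def
  by (auto simp: vec_eq_iff intro!: sum.cong)

lemma std_dir_supported: "std_dir A f S t u \<in> supported S"
  by (simp add: std_dir_def supported_def)

text \<open>The residual of the Gram system lies in the kernel of G and is supported on S, where
  injectivity makes that kernel trivial.\<close>

lemma std_dir_normal_eq:
  fixes A :: "real^'n^'m"
  assumes inj: "\<And>x. x \<in> supported S \<Longrightarrow> A *v x = 0 \<Longrightarrow> x = 0" and i: "i \<in> S"
  shows "column i A \<bullet> (A *v std_dir A f S t u) = dual A f t u $ i"
proof -
  define M where "M = cols A S"
  define G where "G = transpose M ** M"
  define X where "X = pinv G"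
  define p where "p = subvec (dual A f t u) S"
  define d where "d = std_dir A f S t u"
  have Gt: "transpose G = G"
    by (simp add: G_def matrix_transpose_mul)
  have X: "G ** X ** G = G" "transpose (G ** X) = G ** X"
    using is_pinv_pinv[of G] by (auto simp: is_pinv_def X_def)
  \<comment> \<open>Transposing \<open>G ** X ** G = G\<close> and using the symmetry of G and of
    \<open>G ** X\<close> gives \<open>G ** (G ** X) = G\<close>, which is what annihilates the
    residual under G.\<close>
  have "G ** transpose X ** G = transpose (G ** X ** G)"
    by (simp add: matrix_transpose_mul Gt matrix_mul_assoc)
  then have "G ** (transpose X ** G) = G"
    by (simp only: X(1) Gt matrix_mul_assoc)
  moreover have "transpose X ** G = G ** X"
    using X(2) by (simp only: matrix_transpose_mul Gt)
  ultimately have GGX: "G ** (G ** X) = G"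
    by simp
  have M_outside: "(transpose M *v y) $ k = 0" if "k \<notin> S" for y k
    using that by (simp add: matrix_vector_mult_def transpose_def M_def cols_def)
  have M_inside: "(y v* M) $ k = column k A \<bullet> y" if "k \<in> S" for y k
    using that by (simp add: vector_matrix_mult_nth column_def M_def cols_def inner_vec_def)
  have d: "d = X *v p"
  proof -
    have "(X *v p) $ k = 0" if "k \<notin> S" for k
      using pinv_gram_outside[where A = A and S = S and i = k] that
      by (simp add: X_def G_def M_def matrix_vector_mult_def)
    then show ?thesis
      by (auto simp: d_def std_dir_def vec_eq_iff X_def G_def M_def p_def)
  qed
  define y where "y = p - G *v d"
  have "G *v y = 0"
    using GGX
    by (simp add: y_def d matrix_vector_mult_diff_distrib matrix_vector_mul_assoc matrix_mul_assoc)
  then have "y \<bullet> (G *v y) = 0"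
    by simp
  then have "M *v y = 0"
    by (simp add: G_def matrix_vector_mul_assoc[symmetric])
      (metis dot_lmul_matrix inner_commute inner_eq_zero_iff vector_transpose_matrix)
  moreover have ys: "y \<in> supported S"
    using M_outside
    by (auto simp: supported_def y_def p_def subvec_def G_def matrix_vector_mul_assoc[symmetric])
  ultimately have "y = 0"
    using inj by (simp add: M_def cols_mult_supported)
  then have "p $ i = (G *v d) $ i"
    by (simp add: y_def)
  also have "\<dots> = (transpose M *v (A *v d)) $ i"
    by (simp add: G_def matrix_vector_mul_assoc[symmetric] M_def cols_mult_supported d_def
        std_dir_supported)
  finally show ?thesis
    using i by (simp add: M_inside p_def subvec_def d_def)
qed

section \<open>Strict complementarity along the standard path\<close>

text \<open>A strictly complementary version of \<open>kkt_dir\<close>, with L the leaving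
  coordinates: every other inactive equicorrelated coordinate enters with the correct sign, and
  every coordinate in L drops out of the equicorrelation set at once.\<close>

definition strict_dir ::
    "real^'n^'m \<Rightarrow> real^'m \<Rightarrow> real \<Rightarrow> real^'n \<Rightarrow> 'n set \<Rightarrow> real^'n \<Rightarrow> bool" where
  "strict_dir A f t u L d \<longleftrightarrow>
     L \<subseteq> equicorr A f t u - active u \<and> d \<in> supported (equicorr A f t u - L) \<and>
     (\<forall>i\<in>equicorr A f t u - L. column i A \<bullet> (A *v d) = dual A f t u $ i) \<and>
     (\<forall>i\<in>equicorr A f t u - L - active u. d $ i * dual A f t u $ i > 0) \<and>
     (\<forall>i\<in>L. dual A f t u $ i * (column i A \<bullet> (A *v d)) > 1)"

lemma strict_dir_imp_kkt_dir:
  assumes "strict_dir A f t u L d" "t > 0" "active u \<subseteq> equicorr A f t u"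
  shows "kkt_dir A f t u d"
  unfolding kkt_dir_def
proof (intro conjI ballI impI)
  show "d \<in> supported (equicorr A f t u)"
    using assms by (auto simp: strict_dir_def supported_def)
  show "column i A \<bullet> (A *v d) = dual A f t u $ i" if "i \<in> active u" for i
    using assms that by (auto simp: strict_dir_def)
  fix i assume i: "i \<in> equicorr A f t u - active u"
  show "column i A \<bullet> (A *v d) = dual A f t u $ i" if "d $ i \<noteq> 0"
    using assms that i by (auto simp: strict_dir_def supported_def)
  show "0 \<le> d $ i * dual A f t u $ i"
    using assms i by (cases "i \<in> L") (auto simp: strict_dir_def supported_def intro: less_imp_le)
  show "1 \<le> dual A f t u $ i * (column i A \<bullet> (A *v d))"
    using assms i dual_square[of t i A f u]
    by (cases "i \<in> L") (auto simp: strict_dir_def intro: less_imp_le)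
qed

text \<open>Only the i-th term of the expansion of the square survives. Positivity of the left side
  then ties the signs of the two factors on the right together.\<close>

lemma norm_square_one_coordinate:
  assumes e: "e \<in> supported (insert i P)" and orth: "\<And>k. k \<in> P \<Longrightarrow> column k A \<bullet> (A *v e) = 0"
  shows "(norm (A *v e))\<^sup>2 = e $ i * (column i A \<bullet> (A *v e))"
proof -
  have "(norm (A *v e))\<^sup>2 = (\<Sum>k\<in>UNIV. e $ k * (column k A \<bullet> (A *v e)))"
    by (simp only: power2_norm_eq_inner inner_mult_eq_sum)
  also have "\<dots> = e $ i * (column i A \<bullet> (A *v e)) +
      (\<Sum>k\<in>UNIV - {i}. e $ k * (column k A \<bullet> (A *v e)))"
    by (rule sum.remove) auto
  also have "(\<Sum>k\<in>UNIV - {i}. e $ k * (column k A \<bullet> (A *v e))) = 0"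
    using e orth by (intro sum.neutral) (auto simp: supported_def)
  finally show ?thesis
    by simp
qed

text \<open>At u = 0 nothing is active, so at most one coordinate is involved and the positive
  squared norm of \<open>A *v d\<close> is exactly the product whose sign is wanted.\<close>

lemma strict_dir_initial:
  fixes A :: "real^'n^'m"
  assumes t: "t > 0" and card: "card (equicorr A f t 0) \<le> 1"
    and d: "d \<in> supported (equicorr A f t 0)"
    and eq: "\<And>i. i \<in> equicorr A f t 0 \<Longrightarrow> column i A \<bullet> (A *v d) = dual A f t 0 $ i"
  shows "strict_dir A f t 0 {} d"
proof -
  have "d $ i * dual A f t 0 $ i > 0" if i: "i \<in> equicorr A f t 0" for i
  proof -
    have "equicorr A f t 0 = {i}"
      using card i by (auto simp: card_le_Suc0_iff_eq)
    then have "(norm (A *v d))\<^sup>2 = d $ i * dual A f t 0 $ i"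
      using norm_square_one_coordinate[of d i "{}" A] d eq[OF i] by simp
    moreover have "A *v d \<noteq> 0"
      using eq[OF i] abs_dual[OF t i] by auto
    ultimately show ?thesis
      by (metis zero_less_norm_iff zero_less_power)
  qed
  then show ?thesis
    using d eq by (auto simp: strict_dir_def active_def)
qed

text \<open>At most one inactive coordinate i is equicorrelated, and the product formula for e = d -
  d' relates its two strict inequalities. If i leaves, d vanishes there and the sign of d' is known;
  if it hits or returns, d' vanishes there and the old slope is known. Either way the sign of one
  factor determines that of the other.\<close>

lemma strict_dir_step:
  fixes A :: "real^'n^'m"
  assumes t: "0 < t" "t < t'"
    and u': "u' \<in> lasso A f t'" and u: "u \<in> lasso A f t"
    and move: "u = u' + (t' - t) *\<^sub>R d'"
    and strict: "strict_dir A f t' u' L' d'"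
    and L: "L = active u' - active u"
    and one: "card ((equicorr A f t u - equicorr A f t' u') \<union> L) \<le> 1"
    and L'_card: "card L' \<le> 1"
    and alone: "L' \<inter> equicorr A f t u \<noteq> {} \<Longrightarrow>
      (equicorr A f t u - equicorr A f t' u') \<union> L = {}"
    and inj: "\<And>x. x \<in> supported (equicorr A f t u) \<Longrightarrow> A *v x = 0 \<Longrightarrow> x = 0"
    and d: "d \<in> supported (equicorr A f t u - L)"
    and eq: "\<And>i. i \<in> equicorr A f t u - L \<Longrightarrow> column i A \<bullet> (A *v d) = dual A f t u $ i"
  shows "strict_dir A f t u L d"
proof -
  define E where "E = equicorr A f t u"
  define E' where "E' = equicorr A f t' u'"
  define p where "p = dual A f t u"
  define p' where "p' = dual A f t' u'"
  define b where "b = (\<lambda>i. column i A \<bullet> (A *v d))"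
  define b' where "b' = (\<lambda>i. column i A \<bullet> (A *v d'))"
  have t': "t' > 0"
    using t by simp
  note old = strict[unfolded strict_dir_def, folded E'_def p'_def]
  have old_eq: "b' i = p' $ i" if "i \<in> E' - L'" for i
    using old that by (auto simp: b'_def)
  have d'_zero: "d' $ i = 0" if "i \<notin> E' - L'" for i
    using old that by (auto simp: supported_def)
  have corr: "corr A f u i = corr A f u' i - (t' - t) * b' i" for i
    by (simp add: move corr_move b'_def)
  have P: "active u \<subseteq> E"
    unfolding E_def using t u by (intro active_subset_equicorr)
  have act': "active u' \<subseteq> E' - L'"
    using active_subset_equicorr[OF t' u'] old by (auto simp: E'_def)
  \<comment> \<open>These correlations shrink proportionally to the parameter, so they stay on the
    boundary with unchanged sign.\<close>
  have kept: "p $ i = p' $ i" "i \<in> E" if "i \<in> E' - L'" for i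
  proof -
    have "corr A f u i = t * p' $ i"
      unfolding corr old_eq[OF that] using t' by (simp add: p'_def dual_nth field_simps)
    moreover have "\<bar>p' $ i\<bar> = 1"
      unfolding p'_def using t' that by (intro abs_dual) (auto simp: E'_def)
    ultimately show "p $ i = p' $ i" "i \<in> E"
      using t by (auto simp: p_def dual_nth E_def mem_equicorr_iff abs_mult)
  qed
  have act_kept: "active u \<subseteq> E' - L'"
  proof
    fix i assume "i \<in> active u"
    then have "u' $ i \<noteq> 0 \<or> d' $ i \<noteq> 0"
      by (auto simp: active_def move)
    then show "i \<in> E' - L'"
      using act' d'_zero by (auto simp: active_def)
  qed
  have LE: "L \<subseteq> E - active u"
    using act' kept(2) unfolding L by blast
  \<comment> \<open>An inactive equicorrelated coordinate has hit, left or returned. Strictness at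
    the previous breakpoint excludes the remaining case, an old inactive coordinate outside
    \<open>L'\<close> that did not move.\<close>
  have sub: "E - active u \<subseteq> (E - E') \<union> L \<union> (L' \<inter> E)"
  proof
    fix i assume i: "i \<in> E - active u"
    have "i \<in> L'" if "i \<in> E'" "i \<notin> active u'"
    proof (rule ccontr)
      assume "i \<notin> L'"
      then have "d' $ i * p' $ i > 0"
        using old that by auto
      moreover have "d' $ i = 0"
        using i that t by (simp add: active_def move)
      ultimately show False
        by simp
    qed
    then show "i \<in> (E - E') \<union> L \<union> (L' \<inter> E)"
      using i by (auto simp: L)
  qed
  have card: "card (E - active u) \<le> 1"
  proof (cases "L' \<inter> E = {}")
    case True
    then have "card (E - active u) \<le> card ((E - E') \<union> L)"
      using sub by (intro card_mono) auto
    then show ?thesis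
      using one by (simp add: E_def E'_def)
  next
    \<comment> \<open>A return occurs, so \<open>alone\<close> rules out hits and leaves, and the
      inactive coordinates all come from \<open>L'\<close>.\<close>
    case False
    then have "E - active u \<subseteq> L'"
      using sub alone by (auto simp: E_def E'_def)
    then have "card (E - active u) \<le> card L'"
      by (intro card_mono) auto
    then show ?thesis
      using L'_card by simp
  qed
  have new: "(i \<in> L \<longrightarrow> p $ i * b i > 1) \<and> (i \<notin> L \<longrightarrow> d $ i * p $ i > 0)"
    if i: "i \<in> E - active u" for i
  proof -
    have "E - active u = {i}"
      using card i by (auto simp: card_le_Suc0_iff_eq)
    then have E: "E = insert i (active u)"
      using P i by blast
    have pp: "p $ i * p $ i = 1"
      unfolding p_def using t i by (intro dual_square) (auto simp: E_def)
    have ui: "u $ i = 0"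
      using i by (simp add: active_def)
    \<comment> \<open>Both directions have the same correlation slopes on \<open>active u\<close>,
      so \<open>norm_square_one_coordinate\<close> applies with \<open>P = active u\<close>.\<close>
    define e where "e = d - d'"
    have be: "column k A \<bullet> (A *v e) = b k - b' k" for k
      by (simp add: e_def b_def b'_def matrix_vector_mult_diff_distrib inner_diff_right)
    have e: "e \<in> supported E"
      using d kept(2) d'_zero by (auto simp: supported_def e_def E_def)
    have "column k A \<bullet> (A *v e) = 0" if k: "k \<in> active u" for k
    proof -
      have "b k = p $ k"
        unfolding b_def p_def using k P L by (intro eq) (auto simp: E_def)
      moreover have "b' k = p $ k"
        using k act_kept old_eq kept(1) by auto
      ultimately show ?thesis
        by (simp add: be)
    qed
    then have norm: "(norm (A *v e))\<^sup>2 = e $ i * (b i - b' i)"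
      using e unfolding E by (subst norm_square_one_coordinate[of e i "active u"]) (auto simp: be)
    have pos: "(norm (A *v e))\<^sup>2 > 0" if "e \<noteq> 0"
      using inj[of e] e that by (auto simp: E_def)
    show ?thesis
    proof (intro conjI impI)
      assume "i \<in> L"
      then have i': "i \<in> active u'" "i \<in> E' - L'"
        using L act' by auto
      then have "u' $ i \<noteq> 0"
        by (simp add: active_def)
      then have p: "p $ i = sgn (u' $ i)"
        using kept(1)[OF i'(2)] dual_active[OF t' u'] by (simp add: p'_def)
      \<comment> \<open>The coordinate moved from a nonzero value to 0, hence against its own
        sign.\<close>
      have "(t' - t) * (d' $ i * p $ i) = - \<bar>u' $ i\<bar>"
        using ui \<open>u' $ i \<noteq> 0\<close> by (simp add: move p sgn_if split: if_splits)
      then have neg: "d' $ i * p $ i < 0"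
        using t \<open>u' $ i \<noteq> 0\<close> by (smt (verit) zero_le_mult_iff)
      have "d $ i = 0"
        using d \<open>i \<in> L\<close> by (simp add: supported_def)
      then have ei: "e $ i = - (d' $ i)"
        by (simp add: e_def)
      then have "e \<noteq> 0"
        using neg by auto
      have b'i: "b' i = p $ i"
        using old_eq kept(1) i' by simp
      have "(- (d' $ i * p $ i)) * (p $ i * b i - 1) = - (d' $ i) * (b i - p $ i)"
        using pp by algebra
      then have "(- (d' $ i * p $ i)) * (p $ i * b i - 1) > 0"
        using pos[OF \<open>e \<noteq> 0\<close>] unfolding norm ei b'i by (simp only:)
      then have "0 < p $ i * b i - 1"
        by (rule zero_less_mult_pos) (use neg in simp)
      then show "1 < p $ i * b i"
        by simp
    next
      assume "i \<notin> L"
      have iE: "i \<in> E - L"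
        using i \<open>i \<notin> L\<close> by blast
      have bi: "b i = p $ i"
        unfolding b_def p_def using iE by (intro eq) (auto simp: E_def)
      have cases: "i \<notin> E' \<or> i \<in> L'"
        using sub i \<open>i \<notin> L\<close> by blast
      then have ei: "e $ i = d $ i"
        using d'_zero[of i] by (simp add: e_def)
      have ci: "corr A f u' i = t * p $ i + (t' - t) * b' i"
        using corr[of i] t by (simp add: p_def dual_nth)
      \<comment> \<open>For a hit, the signed correlation goes from below t' to exactly t. For a
        return, leaving the boundary with slope above 1 excludes a return with the old sign, so the
        sign is reversed.\<close>
      have lt: "p $ i * b' i < 1"
        using cases
      proof
        assume "i \<notin> E'"
        then have "\<bar>corr A f u' i\<bar> < t'"
          using lasso_corr_le[OF t' u', of i] by (auto simp: E'_def mem_equicorr_iff)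
        moreover have "\<bar>p $ i\<bar> = 1"
          unfolding p_def using t i by (intro abs_dual) (auto simp: E_def)
        ultimately have "p $ i * corr A f u' i < t'"
          using abs_ge_self[of "p $ i * corr A f u' i"] by (simp add: abs_mult)
        moreover have "p $ i * corr A f u' i = t + (t' - t) * (p $ i * b' i)"
          unfolding ci using pp by algebra
        ultimately have "(t' - t) * (p $ i * b' i) < (t' - t) * 1"
          by simp
        then show ?thesis
          using t by simp
      next
        assume "i \<in> L'"
        then have gt: "p' $ i * b' i > 1" and iE': "i \<in> E'"
          using old by (auto simp: b'_def)
        have p': "\<bar>p' $ i\<bar> = 1" "p' $ i * p' $ i = 1"
          using abs_dual[OF t'] dual_square[OF t'] iE' unfolding p'_def E'_def by blast+
        have "corr A f u' i = t' * p' $ i"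
          using t' by (simp add: p'_def dual_nth)
        have "p $ i \<noteq> p' $ i"
        proof
          assume same: "p $ i = p' $ i"
          have "(t' - t) * b' i = (t' - t) * p $ i"
            using ci \<open>corr A f u' i = t' * p' $ i\<close> same by (simp add: algebra_simps)
          then show False
            using t gt same p' by simp
        qed
        moreover have "\<bar>p $ i\<bar> = 1"
          unfolding p_def using t i by (intro abs_dual) (auto simp: E_def)
        ultimately have "p $ i = - p' $ i"
          using p'(1) by (simp add: abs_if split: if_splits)
        then show ?thesis
          using gt by simp
      qed
      then have "b i - b' i \<noteq> 0"
        using bi pp by auto
      then have "e \<noteq> 0"
        using be[of i] by auto
      have "(1 - p $ i * b' i) * (d $ i * p $ i) = d $ i * (p $ i - b' i)"
        using pp by algebra
      then have "(1 - p $ i * b' i) * (d $ i * p $ i) > 0"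
        using pos[OF \<open>e \<noteq> 0\<close>] unfolding norm ei bi by (simp only:)
      then show "0 < d $ i * p $ i"
        by (rule zero_less_mult_pos) (use lt in simp)
    qed
  qed
  show ?thesis
    unfolding strict_dir_def
    using LE d eq new by (auto simp: E_def p_def b_def)
qed

section \<open>The standard method\<close>

text \<open>The direction that \<open>std_iter\<close> computes inline, named so that
  \<open>std_Suc\<close> can state the recursion without the stored active set.\<close>

definition std_d :: "real^'n^'m \<Rightarrow> real^'m \<Rightarrow> nat \<Rightarrow> real^'n" where
  "std_d A f j = std_dir A f (std_equi A f j - leav A f j) (std_t A f j) (std_u A f j)"

lemma fst_std_iter: "fst (std_iter A f j) = (case j of 0 \<Rightarrow> {} | Suc i \<Rightarrow> active (std_u A f i))"
  by (cases j) (auto simp: std_u_def Let_def split: prod.splits)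

lemma std_Suc:
  "std_t A f (Suc j) = next_t A f (std_t A f j) (std_u A f j) (std_d A f j)"
  "std_u A f (Suc j) = std_u A f j + (std_t A f j - std_t A f (Suc j)) *\<^sub>R std_d A f j"
  using fst_std_iter[of A f j]
  by (auto simp: std_t_def std_u_def std_d_def std_equi_def leav_def Let_def split: prod.splits)

lemma std_zero: "std_t A f 0 = infnorm (transpose A *v f)" "std_u A f 0 = 0"
  by (auto simp: std_t_def std_u_def)

text \<open>This holds for all entries, even after a stop or an error, because \<open>next_t\<close>
  at worst returns the current parameter.\<close>

lemma std_lasso: "std_t A f j \<ge> 0 \<and> std_u A f j \<in> lasso A f (std_t A f j)"
proof (induction j)
  case 0
  then show ?case
    unfolding std_zero by (intro conjI infnorm_pos_le zero_in_lasso)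
next
  case (Suc j)
  then have "0 \<le> std_t A f j" "std_u A f j \<in> lasso A f (std_t A f j)"
    by auto
  then show ?case
    using next_t_nonneg next_t_path[OF _ _ order_refl next_t_le] unfolding std_Suc by blast
qed

lemmas std_t_nonneg = std_lasso[THEN conjunct1] and std_u_lasso = std_lasso[THEN conjunct2]

lemma std_t_decr: "std_t A f (Suc j) \<le> std_t A f j"
  unfolding std_Suc by (rule next_t_le[OF std_u_lasso std_t_nonneg])

lemma std_path:
  assumes "std_t A f (Suc j) \<le> r" "r \<le> std_t A f j"
  shows "std_u A f j + (std_t A f j - r) *\<^sub>R std_d A f j \<in> lasso A f r"
  using assms next_t_path[OF std_u_lasso std_t_nonneg] unfolding std_Suc by blast

lemma std_d_supported: "std_d A f j \<in> supported (std_equi A f j - leav A f j)"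
  by (simp add: std_d_def std_dir_supported)

lemma std_d_equi: "std_d A f j \<in> supported (std_equi A f j)"
  using std_d_supported[of A f j] by (auto simp: supported_def)

text \<open>For a fixed sign pattern the optimality conditions are linear equations and convex
  inequalities jointly in the parameter and the solution.\<close>

lemma segment_same_sign_lasso:
  assumes a: "a > 0" "u \<in> lasso A f a" and b: "b > 0" "v \<in> lasso A f b"
    and sgn: "\<And>i. sgn (u $ i) = sgn (v $ i)" and x: "0 \<le> x" "x \<le> 1"
  shows "(1 - x) *\<^sub>R u + x *\<^sub>R v \<in> lasso A f ((1 - x) * a + x * b)"
proof -
  have pos: "(1 - x) * a + x * b > 0"
    using a(1) b(1) x by (cases "x = 0") (auto intro!: add_nonneg_pos)
  have c: "corr A f ((1 - x) *\<^sub>R u + x *\<^sub>R v) i = (1 - x) * corr A f u i + x * corr A f v i" for i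
    by (simp add: corr_def matrix_vector_right_distrib matrix_vector_mult_scaleR inner_diff_right
        inner_add_right algebra_simps)
  show ?thesis
    unfolding lasso_iff[OF pos]
  proof (intro allI conjI impI)
    fix i
    have "\<bar>(1 - x) * corr A f u i + x * corr A f v i\<bar> \<le>
        (1 - x) * \<bar>corr A f u i\<bar> + x * \<bar>corr A f v i\<bar>"
      using x abs_triangle_ineq[of "(1 - x) * corr A f u i" "x * corr A f v i"]
      by (simp add: abs_mult)
    also have "\<dots> \<le> (1 - x) * a + x * b"
      using x lasso_corr_le[OF a] lasso_corr_le[OF b] by (intro add_mono mult_left_mono) auto
    finally show "\<bar>corr A f ((1 - x) *\<^sub>R u + x *\<^sub>R v) i\<bar> \<le> (1 - x) * a + x * b"
      by (simp add: c)
  next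
    fix i
    let ?w = "((1 - x) *\<^sub>R u + x *\<^sub>R v) $ i"
    assume nz: "?w \<noteq> 0"
    then have u: "u $ i \<noteq> 0" and v: "v $ i \<noteq> 0"
      using sgn[of i] by (auto simp: sgn_zero_iff)
    have abs: "?w = sgn (u $ i) * ((1 - x) * \<bar>u $ i\<bar> + x * \<bar>v $ i\<bar>)"
      using mult_sgn_abs[of "u $ i"] mult_sgn_abs[of "v $ i"] sgn[of i] by (simp add: algebra_simps)
    moreover have "(1 - x) * \<bar>u $ i\<bar> + x * \<bar>v $ i\<bar> \<ge> 0"
      using x by auto
    moreover have "(1 - x) * \<bar>u $ i\<bar> + x * \<bar>v $ i\<bar> \<noteq> 0"
      using abs nz by force
    ultimately have "sgn ?w = sgn (u $ i)"
      by (simp only: sgn_mult sgn_sgn) (simp add: sgn_if)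
    then show "corr A f ((1 - x) *\<^sub>R u + x *\<^sub>R v) i = ((1 - x) * a + x * b) * sgn ?w"
      using lasso_corr_active[OF a u] lasso_corr_active[OF b v] sgn[of i]
      unfolding c by (simp add: distrib_right)
  qed
qed

text \<open>If a sign pattern recurred after a breakpoint, the linear piece before that breakpoint
  could be prolonged beyond it, so there are at most as many pieces as sign patterns.\<close>

lemma std_terminates:
  fixes A :: "real^'n^'m"
  assumes pos: "\<And>j. std_t A f j > 0" and decr: "\<And>j. std_t A f (Suc j) < std_t A f j"
    and inj: "\<And>j x. x \<in> supported (std_equi A f j) \<Longrightarrow> A *v x = 0 \<Longrightarrow> x = 0"
  shows False
proof -
  let ?t = "std_t A f" and ?u = "std_u A f" and ?d = "std_d A f"
  define m where "m j = (?t j + ?t (Suc j)) / 2" for j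
  define q where "q j r = ?u j + (?t j - r) *\<^sub>R ?d j" for j r
  define \<sigma> where "\<sigma> j = (\<lambda>i. sgn (q j (m j) $ i))" for j
  have m: "?t (Suc j) < m j" "m j < ?t j" for j
    using decr[of j] by (auto simp: m_def)
  have m_pos: "m j > 0" for j
    using m(1)[of j] pos[of "Suc j"] by linarith
  have m_sol: "q j (m j) \<in> lasso A f (m j)" for j
    unfolding q_def using m[of j] by (intro std_path) auto
  have anti: "?t k \<le> ?t j" if "j \<le> k" for j k
    using that by (rule lift_Suc_antimono_le[of ?t, rotated]) (rule std_t_decr)
  have sgn_values: "sgn x \<in> {-1, 0, 1}" for x :: real
    by (simp add: sgn_if)
  have "range \<sigma> \<subseteq> (\<Pi>\<^sub>E i\<in>UNIV. {-1, 0, 1})"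
    unfolding \<sigma>_def by (intro image_subsetI PiE_I sgn_values) simp
  then have "finite (range \<sigma>)"
    by (rule finite_subset) (intro finite_PiE finite, simp)
  then have "\<not> inj \<sigma>"
    using finite_imageD by blast
  then obtain j k where jk: "j < k" "\<sigma> j = \<sigma> k"
    by (metis injI linorder_neqE_nat)
  define a where "a = m j"
  define b where "b = m k"
  define s where "s = ?t (Suc j)"
  have b_s: "b < s"
    using m(2)[of k] anti[of "Suc j" k] jk by (simp add: b_def s_def)
  have s_a: "s < a" "a < ?t j"
    using m[of j] by (auto simp: a_def s_def)
  have ab: "a > 0" "b > 0"
    using m_pos by (auto simp: a_def b_def)
  have sg: "sgn (q j a $ i) = sgn (q k b $ i)" for i
    using fun_cong[OF jk(2), of i] by (simp add: \<sigma>_def a_def b_def)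
  have seg: "(1 - x) *\<^sub>R q j a + x *\<^sub>R q k b \<in> lasso A f ((1 - x) * a + x * b)"
    if "0 \<le> x" "x \<le> 1" for x
    using ab m_sol[of j] m_sol[of k] sg that unfolding a_def[symmetric] b_def[symmetric]
    by (intro segment_same_sign_lasso) auto
  have q_supp: "q j r \<in> supported (std_equi A f j)" for r
  proof -
    have "active (?u j) \<subseteq> std_equi A f j"
      unfolding std_equi_def by (rule active_subset_equicorr[OF pos std_u_lasso])
    then show ?thesis
      using std_d_equi[of A f j] by (auto simp: supported_def q_def active_def)
  qed
  \<comment> \<open>Equal signs mean equal zeros, so the later point inherits the support of piece j
    and injectivity applies to it.\<close>
  have "q k b \<in> supported (std_equi A f j)"
    using q_supp[of a] sg by (auto simp: supported_def) (metis sgn_zero_iff)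
  \<comment> \<open>The weight at which the segment from \<open>q j a\<close> to
    \<open>q k b\<close> passes the parameter s of the breakpoint ending piece j.\<close>
  define x where "x = (a - s) / (a - b)"
  have x: "0 < x" "x < 1"
    using b_s s_a by (auto simp: x_def)
  have "x * (a - b) = a - s"
    using b_s s_a by (simp add: x_def)
  then have xs: "(1 - x) * a + x * b = s"
    by (simp add: algebra_simps)
  define w where "w = (1 - x) *\<^sub>R q j a + x *\<^sub>R q k b"
  have "w \<in> lasso A f s"
    using seg[of x] x xs by (simp add: w_def)
  moreover have "q j s \<in> lasso A f s"
    unfolding q_def s_def using decr[of j] by (intro std_path) auto
  ultimately have "A *v (w - q j s) = 0"
    using lasso_fit_unique[of s] pos[of "Suc j"] by (simp add: s_def matrix_vector_mult_diff_distrib)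
  moreover have "w - q j s \<in> supported (std_equi A f j)"
    using q_supp[of a] q_supp[of s] \<open>q k b \<in> _\<close> by (auto simp: supported_def w_def)
  ultimately have ws: "w = q j s"
    using inj by force
  have affine: "(1 - y) *\<^sub>R q j a + y *\<^sub>R q j b = q j ((1 - y) * a + y * b)" for y
    by (simp add: q_def algebra_simps)
  \<comment> \<open>The segment and the prolonged piece j agree at a and at s, so they are the same
    line and also agree at b.\<close>
  have "(1 - x) *\<^sub>R q j a + x *\<^sub>R q k b = (1 - x) *\<^sub>R q j a + x *\<^sub>R q j b"
    unfolding affine[of x] xs using ws by (simp only: w_def)
  then have qb: "q k b = q j b"
    using x by simp
  \<comment> \<open>From the start of the piece down to a the path itself consists of solutions, and
    from a down to b the segment does. Since b < s, this contradicts the minimality of the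
    breakpoint.\<close>
  have "next_t A f (?t j) (?u j) (?d j) \<le> b"
  proof (rule next_t_least[OF std_u_lasso std_t_nonneg])
    fix r assume r: "b \<le> r" "r \<le> ?t j"
    have "q j r \<in> lasso A f r"
    proof (cases "r \<le> a")
      case True
      define y where "y = (a - r) / (a - b)"
      have y: "0 \<le> y" "y \<le> 1"
        using True r b_s s_a by (auto simp: y_def)
      have "y * (a - b) = a - r"
        using b_s s_a by (simp add: y_def)
      then have "(1 - y) * a + y * b = r"
        by (simp add: algebra_simps)
      then show ?thesis
        using seg[OF y] affine[of y] qb by simp
    next
      case False
      then show ?thesis
        unfolding q_def using r s_a by (intro std_path) (auto simp: s_def)
    qed
    then show "?u j + (?t j - r) *\<^sub>R ?d j \<in> lasso A f r"
      by (simp add: q_def)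
  qed (use ab b_s s_a in auto)
  then show False
    using b_s by (simp add: s_def std_Suc)
qed

section \<open>Comparison of the two methods\<close>

text \<open>The induction carries \<open>strict_dir\<close> rather than \<open>kkt_dir\<close>
  because the next breakpoint is analysed through the strict inequalities at the current
  one.\<close>

lemma std_strict:
  fixes A :: "real^'n^'m"
  assumes one: "one_at_a_time A f" and alone: "returns_alone A f"
    and inj: "\<And>j x. std_reaches A f j \<Longrightarrow> std_t A f j > 0 \<Longrightarrow>
      x \<in> supported (std_equi A f j) \<Longrightarrow> A *v x = 0 \<Longrightarrow> x = 0"
  shows "std_reaches A f j \<Longrightarrow> std_t A f j > 0 \<Longrightarrow>
    strict_dir A f (std_t A f j) (std_u A f j) (leav A f j) (std_d A f j)"
proof (induction j)
  case 0
  have normal: "column i A \<bullet> (A *v std_d A f 0) = dual A f (std_t A f 0) (std_u A f 0) $ i"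
    if "i \<in> std_equi A f 0 - leav A f 0" for i
    unfolding std_d_def using that inj[OF 0]
    by (intro std_dir_normal_eq) (auto simp: supported_def)
  have "card (hit A f 0 \<union> leav A f 0) \<le> 1"
    using one 0 unfolding one_at_a_time_def by blast
  then show ?case
    using strict_dir_initial[of "std_t A f 0" A f "std_d A f 0"] 0 normal std_d_equi[of A f 0]
    by (simp add: hit_def leav_def std_equi_def std_zero)
next
  case (Suc j)
  \<comment> \<open>Reaching iteration \<open>Suc j\<close> excludes an error at j, so the parameter
    has strictly decreased.\<close>
  have reach: "std_reaches A f j" and less: "std_t A f (Suc j) < std_t A f j"
    using Suc.prems std_t_decr[of A f j] by (auto simp: std_reaches_def less_Suc_eq order_le_less)
  have pos: "std_t A f j > 0"
    using less Suc.prems by simp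
  have normal: "column i A \<bullet> (A *v std_d A f (Suc j)) =
      dual A f (std_t A f (Suc j)) (std_u A f (Suc j)) $ i"
    if "i \<in> std_equi A f (Suc j) - leav A f (Suc j)" for i
    unfolding std_d_def using that inj[OF Suc.prems]
    by (intro std_dir_normal_eq) (auto simp: supported_def)
  have "card (leav A f j) \<le> card (hit A f j \<union> leav A f j)"
    by (intro card_mono) auto
  then have card: "card (leav A f j) \<le> 1"
    using one reach pos unfolding one_at_a_time_def by (meson le_trans)
  have hl: "hit A f (Suc j) = std_equi A f (Suc j) - std_equi A f j"
    "leav A f (Suc j) = active (std_u A f j) - active (std_u A f (Suc j))"
    by (auto simp: hit_def leav_def)
  show ?case
  proof (rule strict_dir_step)
    show "std_u A f (Suc j) = std_u A f j + (std_t A f j - std_t A f (Suc j)) *\<^sub>R std_d A f j"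
      by (rule std_Suc)
    show "card ((equicorr A f (std_t A f (Suc j)) (std_u A f (Suc j)) -
        equicorr A f (std_t A f j) (std_u A f j)) \<union> leav A f (Suc j)) \<le> 1"
      using one Suc.prems unfolding one_at_a_time_def hl(1)[unfolded std_equi_def, symmetric]
      by blast
    show "(equicorr A f (std_t A f (Suc j)) (std_u A f (Suc j)) -
        equicorr A f (std_t A f j) (std_u A f j)) \<union> leav A f (Suc j) = {}"
      if "leav A f j \<inter> equicorr A f (std_t A f (Suc j)) (std_u A f (Suc j)) \<noteq> {}"
      using alone Suc.prems that
      unfolding returns_alone_def hl(1)[unfolded std_equi_def, symmetric] std_equi_def by blast
    show "x = 0" if "x \<in> supported (equicorr A f (std_t A f (Suc j)) (std_u A f (Suc j)))"
      "A *v x = 0" for x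
      using inj[OF Suc.prems] that by (simp add: std_equi_def)
    show "std_d A f (Suc j) \<in>
        supported (equicorr A f (std_t A f (Suc j)) (std_u A f (Suc j)) - leav A f (Suc j))"
      using std_d_supported[of A f "Suc j"] by (simp add: std_equi_def)
    show "column i A \<bullet> (A *v std_d A f (Suc j)) =
        dual A f (std_t A f (Suc j)) (std_u A f (Suc j)) $ i"
      if "i \<in> equicorr A f (std_t A f (Suc j)) (std_u A f (Suc j)) - leav A f (Suc j)" for i
      using normal that by (simp add: std_equi_def)
  qed (use Suc.IH reach pos less card hl std_u_lasso Suc.prems in auto)
qed

text \<open>Without a stop, every reached iteration has a positive parameter and makes progress,
  hence reports no error; so all iterations are reached, against
  \<open>std_terminates\<close>.\<close>

lemma std_stops_if_returns_alone:
  fixes A :: "real^'n^'m"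
  assumes one: "one_at_a_time A f" and alone: "returns_alone A f"
    and inj: "\<And>j x. std_reaches A f j \<Longrightarrow> std_t A f j > 0 \<Longrightarrow>
      x \<in> supported (std_equi A f j) \<Longrightarrow> A *v x = 0 \<Longrightarrow> x = 0"
  shows "\<exists>K. std_stops A f K"
proof (rule ccontr)
  assume never: "\<nexists>K. std_stops A f K"
  have pos: "std_t A f j > 0" if "std_reaches A f j" for j
    using never that std_t_nonneg[of A f j] by (auto simp: std_stops_def order_le_less)
  have less: "std_t A f (Suc j) < std_t A f j" if "std_reaches A f j" for j
  proof -
    have "kkt_dir A f (std_t A f j) (std_u A f j) (std_d A f j)"
      using std_strict[OF one alone inj that pos[OF that]] pos[OF that]
        active_subset_equicorr[OF pos[OF that] std_u_lasso]
      by (intro strict_dir_imp_kkt_dir) auto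
    then show ?thesis
      unfolding std_Suc by (intro kkt_dir_imp_progress pos that std_u_lasso)
  qed
  have reach: "std_reaches A f j" for j
  proof (induction j)
    case (Suc j)
    then show ?case
      using pos[of j] less[of j] by (auto simp: std_reaches_def less_Suc_eq)
  qed (simp add: std_reaches_def)
  show False
    using std_terminates[OF pos less, OF reach reach] inj[OF reach pos[OF reach]] by blast
qed

theorem theorem5p3:
  fixes A :: "real^'n^'m" and f :: "real^'m"
  assumes "one_at_a_time A f"
    and "\<And>j. std_reaches A f j \<Longrightarrow> std_t A f j > 0 \<Longrightarrow>
           inj_on ((*v) (cols A (std_equi A f j))) (supported (std_equi A f j))"
    and "(\<exists>K. std_stops A f K) \<or> returns_alone A f"
  shows "\<exists>K. std_stops A f K \<and> gen_stops A f K \<and>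
           (\<forall>j\<le>K. std_t A f j = gen_t A f j \<and> std_u A f j = gen_u A f j)"
proof -
  \<comment> \<open>On vectors supported on the equicorrelation set the padded submatrix acts like
    A, so injectivity takes this kernel form.\<close>
  have inj: "x = 0" if "std_reaches A f j" "std_t A f j > 0" "x \<in> supported (std_equi A f j)"
    "A *v x = 0" for j x
  proof (rule inj_onD[OF assms(2)[OF that(1,2)]])
    show "cols A (std_equi A f j) *v x = cols A (std_equi A f j) *v 0"
      using that by (simp add: cols_mult_supported)
    show "0 \<in> supported (std_equi A f j)"
      by (simp add: supported_def)
  qed (fact that)
  obtain K where K: "std_stops A f K"
    using assms(1,3) std_stops_if_returns_alone[of A f] inj by blast
  \<comment> \<open>Before K there is neither a stop nor an error, so the standard step has positive
    length and its direction is optimal by \<open>progress_imp_kkt_dir\<close>.\<close>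
  have dir: "gen_dir A f (std_t A f j) (std_u A f j) = std_d A f j" if "j < K" for j
  proof -
    have reach: "std_reaches A f j" and "std_t A f j \<noteq> 0" "std_t A f (Suc j) \<noteq> std_t A f j"
      using K that by (auto simp: std_stops_def std_reaches_def)
    then have pos: "std_t A f j > 0" and less: "std_t A f (Suc j) < std_t A f j"
      using std_t_nonneg[of A f j] std_t_decr[of A f j] by auto
    have "kkt_dir A f (std_t A f j) (std_u A f j) (std_d A f j)"
      using std_d_equi[of A f j]
      by (intro progress_imp_kkt_dir[OF std_t_nonneg less std_u_lasso _ std_path])
        (auto simp: std_equi_def)
    then show ?thesis
      using pos inj[OF reach pos]
      by (intro kkt_dir_eq_gen_dir) (auto simp: std_equi_def)
  qed
  have eq: "std_t A f j = gen_t A f j \<and> std_u A f j = gen_u A f j" if "j \<le> K" for j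
    using that
  proof (induction j)
    case 0
    show ?case
      by (simp add: std_zero gen_t_def gen_u_def)
  next
    case (Suc j)
    then have IH: "gen_iter A f j = (std_t A f j, std_u A f j)"
      by (simp add: gen_t_def gen_u_def)
    show ?case
      using dir[of j] Suc.prems by (simp add: gen_t_def gen_u_def IH Let_def std_Suc)
  qed
  have "gen_stops A f K"
    using K eq by (auto simp: gen_stops_def std_stops_def std_reaches_def)
  then show ?thesis
    using K eq by blast
qed

end
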